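(* Let $F\in\mathcal{S}^{\sharp}$ and let $g_F$ be the screw function of $F$ (defined in the context). Assume that $F(s)$ has no real nontrivial zeros (that is, $\xi_F(s)$ has no real zeros) except for a possible zero at $s=1/2$. Then the Grand Riemann Hypothesis for $F$ is true if and only if there exists $t_0\ge 0$ such that $\Re(-g_F(t))\ge 0$ for all $t\ge t_0$.
   Context: The extended Selberg class $\mathcal{S}^{\sharp}$ is the class of Dirichlet series $F(s)=\sum_{n\ge1}a_F(n)n^{-s}$ (not identically zero) such that: (S1) the series converges absolutely for $\Re(s)>1$; (S2) there is an integer $m\ge 0$ such that $(s-1)^mF(s)$ extends to an entire function of finite order; the smallest such $m$ is denoted $\mathfrak{m}_F$; (S3) there are $r\ge 0$, $Q>0$, $\lambda_j>0$, $\mu_j\in\mathbb{C}$ with $\Re(\mu_j)\ge 0$ ($1\le j\le r$), and $\omega\in\mathbb{C}$ with $|\omega|=1$, such that $$\xi_F(s):=s^{\mathfrak{m}_F}(s-1)^{\mathfrak{m}_F}Q^s\prod_{j=1}^r\Gamma(\lambda_js+\mu_j)\,F(s)$$ satisfies $\xi_F(s)=\omega\,\overline{\xi_F(1-\bar s)}$. The function $\xi_F$ is entire of order one, and it is determined by $F$ up to a nonzero constant factor (independently of the choice of data in (S3)). The nontrivial zeros of $F(s)$ are the zeros of $\xi_F(s)$. The Grand Riemann Hypothesis (GRH) for $F$ is the assertion that all nontrivial zeros of $F(s)$ lie on the line $\Re(s)=1/2$. Let $\Gamma_F$ be the set of all $\gamma\in\mathbb{C}$ with $\xi_F(1/2-i\gamma)=0$,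 and for $\gamma\in\Gamma_F$ let $m_\gamma$ be the multiplicity of $\gamma$ as a zero of $z\mapsto\xi_F(1/2-iz)$; put $m_0=0$ if $0\notin\Gamma_F$. Let $B_F$ be the constant (which is real) defined by $$iB_F=\lim_{z\to0}\left[\frac{\xi_F'}{\xi_F}\left(\frac12-iz\right)-\frac{im_0}{z}\right].$$ The screw function of $F$ is defined for $t\in\mathbb{R}$ by $$g_F(t):=-iB_Ft-\frac{m_0}{2}t^2+\sum_{\gamma\in\Gamma_F\setminus\{0\}}m_\gamma\frac{e^{-i\gamma t}-1}{\gamma^2}.$$ *)

theory Defs
  imports "HOL-Complex_Analysis.Complex_Analysis"
begin

text \<open>
  A Dirichlet series is given by its coefficients \<open>a 1, a 2, \<dots>\<close>; the value \<open>a 0\<close> is never used.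
\<close>

definition dirichlet_series :: "(nat \<Rightarrow> complex) \<Rightarrow> complex \<Rightarrow> complex" where
  "dirichlet_series a s = (\<Sum>n. a (Suc n) * of_nat (Suc n) powr (- s))"

definition entire_finite_order :: "(complex \<Rightarrow> complex) \<Rightarrow> bool" where
  "entire_finite_order f \<longleftrightarrow>
     f holomorphic_on UNIV \<and>
     (\<exists>\<rho>::real. eventually (\<lambda>s. norm (f s) \<le> exp (norm s powr \<rho>)) at_infinity)"

definition regularizes :: "(nat \<Rightarrow> complex) \<Rightarrow> nat \<Rightarrow> (complex \<Rightarrow> complex) \<Rightarrow> bool" where
  "regularizes a m H \<longleftrightarrow>
     entire_finite_order H \<and> (\<forall>s. Re s > 1 \<longrightarrow> H s = (s - 1) ^ m * dirichlet_series a s)"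

definition pole_order :: "(nat \<Rightarrow> complex) \<Rightarrow> nat" where
  "pole_order a = (LEAST m. \<exists>H. regularizes a m H)"

text \<open>
  The meromorphic continuation of the Dirichlet series. By the identity theorem the entire function
  in the description is unique. If there is a pole at 1, the value there is 0 by the convention
  for division and carries no meaning.
\<close>

definition continuation :: "(nat \<Rightarrow> complex) \<Rightarrow> complex \<Rightarrow> complex" where
  "continuation a s = (THE H. regularizes a (pole_order a) H) s / (s - 1) ^ pole_order a"

text \<open>
  The defining formula of \<open>\<xi>\<close> is meant as an identity of meromorphic functions: it involves the
  poles of the Gamma factors and, possibly, the pole of the series at 1. \<^const>\<open>remove_sings\<close>
  fills in the limit at every removable singularity and the value 0 at every pole.
\<close>

definition xi_fun ::
  "(nat \<Rightarrow> complex) \<Rightarrow> real \<Rightarrow> nat \<Rightarrow> (nat \<Rightarrow> real) \<Rightarrow> (nat \<Rightarrow> complex) \<Rightarrow> complex \<Rightarrow> complex" where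
  "xi_fun a Q r lam mu = remove_sings (\<lambda>s.
     s ^ pole_order a * (s - 1) ^ pole_order a * of_real Q powr s *
     (\<Prod>j=1..r. Gamma (of_real (lam j) * s + mu j)) * continuation a s)"

text \<open>
  \<open>completed a \<xi>\<close>: some choice of data makes the functional equation hold, and \<open>\<xi>\<close> is the
  function built from these data. It is determined by \<open>a\<close> only up to a nonzero constant factor.
\<close>

definition completed :: "(nat \<Rightarrow> complex) \<Rightarrow> (complex \<Rightarrow> complex) \<Rightarrow> bool" where
  "completed a \<xi> \<longleftrightarrow>
     (\<exists>(Q::real) (r::nat) (lam::nat \<Rightarrow> real) (mu::nat \<Rightarrow> complex) (\<omega>::complex).
        Q > 0 \<and> (\<forall>j\<in>{1..r}. lam j > 0 \<and> Re (mu j) \<ge> 0) \<and> norm \<omega> = 1 \<and>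
        \<xi> = xi_fun a Q r lam mu \<and>
        (\<forall>s. \<xi> s = \<omega> * cnj (\<xi> (1 - cnj s))))"

definition extended_selberg_class :: "(nat \<Rightarrow> complex) set" where
  "extended_selberg_class = {a.
     (\<forall>s. Re s > 1 \<longrightarrow> summable (\<lambda>n. norm (a (Suc n) * of_nat (Suc n) powr (- s)))) \<and>
     (\<exists>s. Re s > 1 \<and> dirichlet_series a s \<noteq> 0) \<and>
     (\<exists>m H. regularizes a m H) \<and>
     (\<exists>\<xi>. completed a \<xi>)}"

text \<open>The remaining notions depend on the series only through \<open>\<xi>\<close>, and not on its scaling.\<close>

definition GRH :: "(complex \<Rightarrow> complex) \<Rightarrow> bool" where
  "GRH \<xi> \<longleftrightarrow> (\<forall>s. \<xi> s = 0 \<longrightarrow> Re s = 1 / 2)"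

definition ordinates :: "(complex \<Rightarrow> complex) \<Rightarrow> complex set" where
  "ordinates \<xi> = {\<gamma>. \<xi> (1 / 2 - \<i> * \<gamma>) = 0}"

definition mult :: "(complex \<Rightarrow> complex) \<Rightarrow> complex \<Rightarrow> nat" where
  "mult \<xi> \<gamma> = (if \<gamma> \<in> ordinates \<xi> then nat (zorder (\<lambda>z. \<xi> (1 / 2 - \<i> * z)) \<gamma>) else 0)"

definition B_const :: "(complex \<Rightarrow> complex) \<Rightarrow> complex" where
  "B_const \<xi> = Lim (at 0) (\<lambda>z. deriv \<xi> (1 / 2 - \<i> * z) / \<xi> (1 / 2 - \<i> * z)
                              - \<i> * of_nat (mult \<xi> 0) / z) / \<i>"

definition screw_function :: "(complex \<Rightarrow> complex) \<Rightarrow> real \<Rightarrow> complex" where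
  "screw_function \<xi> t =
     - \<i> * B_const \<xi> * of_real t - of_nat (mult \<xi> 0) / 2 * of_real t ^ 2
     + (\<Sum>\<^sub>\<infinity>\<gamma>\<in>ordinates \<xi> - {0}.
          of_nat (mult \<xi> \<gamma>) * (exp (- \<i> * \<gamma> * of_real t) - 1) / \<gamma> ^ 2)"

end

theory Submission
  imports "HOL-Probability.Probability" "HOL-Real_Asymp.Real_Asymp" Defs
begin

text \<open>
  Under GRH every ordinate is real, and \<open>Re (- g t)\<close> is \<open>m\<^sub>0 / 2 * t\<^sup>2\<close> plus a sum of terms
  \<open>m\<^sub>\<gamma> * (1 - cos (\<gamma> * t)) / \<gamma>\<^sup>2\<close>, because \<open>B\<close> is real by the functional equation.

  Conversely, a constant \<open>C\<close> makes \<open>u t = C + Re (- g t)\<close> nonnegative on all of \<open>t \<ge> 0\<close>. Its Laplace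
  transform is, for large \<open>s\<close>, a sum of partial fractions which is meromorphic in \<open>Re s > 0\<close>
  with poles at the points \<open>- \<i> * \<gamma>\<close> and their conjugates. None of these is real, since \<open>\<xi>\<close> has
  no real zeros besides \<open>1 / 2\<close>. By Landau's argument (the abscissa of convergence of the Laplace transform
  of a nonnegative function is a singularity) the integral converges in all of \<open>Re s > 0\<close>, so there
  are no poles there; as residues of coinciding poles have the same argument, they cannot cancel.
  Hence \<open>Im \<gamma> \<le> 0\<close> for every ordinate, and the functional equation gives equality.

  Convergence of the sum over the zeros does not need the Hadamard product: \<open>\<xi>\<close> is polynomially bounded
  in vertical strips by the Phragmen-Lindelof principle, which with crude bounds for \<open>Gamma\<close> gives
  \<open>\<bar>\<xi> s\<bar> \<le> exp (O (\<bar>s\<bar> powr (3 / 2)))\<close>, and a Jensen-type bound then counts the zeros.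
\<close>

section \<open>Landau's theorem for Laplace transforms\<close>

text \<open>Landau's theorem needs a function with a sign, and \<open>- g\<close> is complex valued,
  so its real part has to be taken. This costs holomorphy: on the real axis the real part of the
  transform is continued by averaging the transform with its reflection in the real axis, which is
  why conjugate poles appear. The constant \<open>C\<close> and the quadratic term only produce a
  pole at \<open>0\<close>, on the boundary of the half-plane in question. The finite order in the
  definition of the class has an unknown exponent, too weak for summing over zeros, where an order
  below 2 is wanted. It serves only as the a priori bound that Phragmen-Lindelof demands. On the
  edges of a wide strip \<open>\<xi>\<close> is controlled by the absolutely convergent series,
  directly or after reflection. The exponent 3/2 is a choice strictly between 1 and 2. Below 2 it
  makes the weights \<open>m / \<bar>\<gamma>\<bar>^2\<close> summable; above 1 it leaves room for a
  logarithm, so that the bound \<open>n ^ n\<close> for a factorial can replace Stirling's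
  formula.\<close>

definition laplace :: "real measure \<Rightarrow> complex \<Rightarrow> complex" where
  "laplace M s = (LINT t|M. exp (- s * of_real t))"

definition laplace_finite :: "real measure \<Rightarrow> real \<Rightarrow> bool" where
  "laplace_finite M x \<longleftrightarrow> (\<integral>\<^sup>+t. ennreal (exp (- x * t)) \<partial>M) < \<infinity>"

text \<open>Up to the sign \<open>(-1) ^ k\<close> these are the Taylor coefficients of
  \<open>laplace M\<close> at \<open>c\<close>. For a measure on the half-line they are nonnegative,
  and Landau's argument rests on this.\<close>

definition laplace_moment :: "real measure \<Rightarrow> real \<Rightarrow> nat \<Rightarrow> real" where
  "laplace_moment M c k = (LINT t|M. t ^ k / fact k * exp (- c * t))"

lemma power_div_fact_le_exp:
  fixes x :: real assumes "x \<ge> 0" shows "x ^ k / fact k \<le> exp x"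
proof -
  have "(\<Sum>n\<in>{k}. x ^ n /\<^sub>R fact n) \<le> (\<Sum>n. x ^ n /\<^sub>R fact n)"
    using assms by (intro sum_le_suminf summable_exp_generic) auto
  thus ?thesis by (simp add: exp_def divide_inverse mult.commute)
qed

lemma sum_power_div_fact_le_exp:
  fixes x :: real assumes "x \<ge> 0" shows "(\<Sum>k<n. x ^ k / fact k) \<le> exp x"
proof -
  have "(\<Sum>k\<in>{..<n}. x ^ k /\<^sub>R fact k) \<le> (\<Sum>k. x ^ k /\<^sub>R fact k)"
    using assms by (intro sum_le_suminf summable_exp_generic) auto
  thus ?thesis by (simp add: exp_def divide_inverse mult.commute)
qed

text \<open>If some coefficient of the difference series did not vanish, its sum would be nonzero in
  a punctured disc; but that sum is identically zero. The constant coefficient is read off at the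
  centre.\<close>

lemma power_series_coeff_unique:
  fixes a b :: "nat \<Rightarrow> complex"
  assumes "r > 0" "\<And>w. w \<in> ball z r \<Longrightarrow> (\<lambda>n. a n * (w - z) ^ n) sums f w"
    and "\<And>w. w \<in> ball z r \<Longrightarrow> (\<lambda>n. b n * (w - z) ^ n) sums f w"
  shows "a = b"
proof
  fix m
  define d where "d n = a n - b n" for n
  have d: "(\<lambda>n. d n * (w - z) ^ n) sums 0" if "norm (w - z) < r" for w
    using sums_diff[OF assms(2,3), of w w] that
    by (simp add: d_def algebra_simps dist_norm norm_minus_commute)
  have "d m = 0"
  proof (cases "m = 0")
    case True
    thus ?thesis using d[of z] assms(1) by simp
  next
    case False
    show ?thesis
    proof (rule ccontr)
      assume nz: "d m \<noteq> 0"
      obtain s where s: "s > 0" "\<And>w. w \<in> cball z s - {z} \<Longrightarrow> (0::complex) \<noteq> 0"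
        by (rule powser_0_nonzero[of r z d "\<lambda>_. 0" m]) (use d nz False assms(1) in auto)
      show False using s(1) s(2)[of "z + of_real s"] by (simp add: dist_norm)
    qed
  qed
  thus "a m = b m" by (simp add: d_def)
qed

context
  fixes M :: "real measure"
  assumes sets_M [measurable_cong]: "sets M = sets borel"
    and nonneg_M: "AE t in M. t \<ge> 0"
begin

lemma laplace_finite_iff: "laplace_finite M x \<longleftrightarrow> integrable M (\<lambda>t. exp (- x * t))"
  unfolding laplace_finite_def integrable_iff_bounded by (auto simp: sets_M)

lemma laplace_finite_mono:
  assumes "laplace_finite M x" "x \<le> y" shows "laplace_finite M y"
proof -
  have "(\<integral>\<^sup>+t. ennreal (exp (- y * t)) \<partial>M) \<le> (\<integral>\<^sup>+t. ennreal (exp (- x * t)) \<partial>M)"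
    using nonneg_M by (intro nn_integral_mono_AE, eventually_elim)
       (use assms in \<open>auto intro!: ennreal_leI mult_right_mono\<close>)
  thus ?thesis using assms unfolding laplace_finite_def by (meson le_less_trans)
qed

lemma moment_integrable:
  assumes "laplace_finite M b" "b < c"
  shows "integrable M (\<lambda>t. t ^ k / fact k * exp (- c * t))"
proof -
  \<comment> \<open>The gap between \<open>c\<close> and \<open>b\<close> pays for the power:
    \<open>t ^ k / fact k\<close> is at most \<open>exp (r * t) / r ^ k\<close>.\<close>
  define r where "r = c - b"
  have r: "r > 0" using assms by (simp add: r_def)
  have "integrable M (\<lambda>t. (1 / r ^ k) * exp (- b * t))"
    using assms(1) unfolding laplace_finite_iff by (rule integrable_mult_right)
  thus ?thesis
  proof (rule Bochner_Integration.integrable_bound)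
    show "AE t in M. norm (t ^ k / fact k * exp (- c * t)) \<le> norm ((1 / r ^ k) * exp (- b * t))"
      using nonneg_M
    proof eventually_elim
      case (elim t)
      have "(r * t) ^ k / fact k \<le> exp (r * t)"
        using elim r by (intro power_div_fact_le_exp) auto
      hence "t ^ k / fact k \<le> exp (r * t) / r ^ k"
        using r by (simp add: field_simps)
      hence "t ^ k / fact k * exp (- c * t) \<le> exp (r * t) / r ^ k * exp (- c * t)"
        by (intro mult_right_mono) auto
      also have "\<dots> = (1 / r ^ k) * exp (- b * t)"
      proof -
        have "exp (r * t) * exp (- c * t) = exp (- b * t)"
          by (simp add: r_def exp_add [symmetric] algebra_simps)
        thus ?thesis by simp
      qed
      finally show ?case using elim r by simp
    qed
  qed auto
qed

text \<open>Write \<open>exp (- s * t)\<close> as \<open>exp (- c * t) * exp ((c - s) * t)\<close>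
  and expand the second factor. Since \<open>s\<close> is closer to \<open>c\<close> than
  \<open>b\<close> is, all partial sums are dominated by \<open>exp (- b * t)\<close>.\<close>

lemma laplace_sums:
  assumes "laplace_finite M b" "b < c" "norm (s - of_real c) < c - b"
  shows "(\<lambda>k. ((-1) ^ k * of_real (laplace_moment M c k)) * (s - of_real c) ^ k) sums laplace M s"
proof -
  define r where "r = norm (s - of_real c)"
  define f where "f k t = exp (- complex_of_real (c * t)) * ((of_real c - s) * of_real t) ^ k / fact k" for k t
  have eq: "f k t = (of_real c - s) ^ k * of_real (t ^ k / fact k * exp (- c * t))" for k t
    by (simp add: f_def power_mult_distrib exp_of_real [symmetric])
  have int: "integrable M (f k)" for k
    unfolding eq by (intro integrable_mult_right integrable_of_real moment_integrable[OF assms(1,2)])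
  have lf: "integral\<^sup>L M (f k) = ((-1) ^ k * of_real (laplace_moment M c k)) * (s - of_real c) ^ k" for k
  proof -
    have "integral\<^sup>L M (f k) = (of_real c - s) ^ k * of_real (laplace_moment M c k)"
      unfolding eq laplace_moment_def
      by (subst integral_mult_right_zero) (simp only: integral_complex_of_real)
    also have "(of_real c - s) ^ k = (-1) ^ k * (s - of_real c) ^ k"
      by (subst power_mult_distrib [symmetric]) simp
    finally show ?thesis by simp
  qed
  have fnorm: "norm (f k t) = exp (- (c * t)) * ((r * t) ^ k / fact k)" if "t \<ge> 0" for k t
    using that by (simp add: f_def norm_mult norm_divide norm_power r_def norm_minus_commute)
  have "(\<lambda>n. LINT t|M. (\<Sum>k<n. f k t)) \<longlonglongrightarrow> (LINT t|M. exp (- s * of_real t))"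
  proof (rule integral_dominated_convergence[where w = "\<lambda>t. exp (- b * t)"])
    show "integrable M (\<lambda>t. exp (- b * t))" using assms(1) unfolding laplace_finite_iff .
    have "(\<lambda>k. f k t) sums exp (- s * of_real t)" for t
    proof -
      have "(\<lambda>k. exp (- complex_of_real (c * t)) * (((of_real c - s) * of_real t) ^ k /\<^sub>R fact k))
             sums (exp (- complex_of_real (c * t)) * exp ((of_real c - s) * of_real t))"
        by (intro sums_mult exp_converges)
      thus ?thesis
        by (simp add: f_def [abs_def] exp_add [symmetric] algebra_simps scaleR_conv_of_real divide_inverse)
    qed
    thus "AE t in M. (\<lambda>n. \<Sum>k<n. f k t) \<longlonglongrightarrow> exp (- s * of_real t)"
      by (auto simp: sums_def)
    show "AE t in M. norm (\<Sum>k<n. f k t) \<le> exp (- b * t)" for n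
      using nonneg_M
    proof eventually_elim
      case (elim t)
      have "norm (\<Sum>k<n. f k t) \<le> (\<Sum>k<n. exp (- (c * t)) * ((r * t) ^ k / fact k))"
        by (rule order_trans[OF norm_sum]) (simp add: fnorm elim)
      also have "\<dots> \<le> exp (- (c * t)) * exp (r * t)"
        unfolding sum_distrib_left [symmetric] using elim
        by (intro mult_left_mono sum_power_div_fact_le_exp) (auto simp: r_def)
      also have "\<dots> \<le> exp (- b * t)"
        unfolding exp_add [symmetric]
        using mult_right_mono[of "r - c" "- b" t] assms(3) elim by (simp add: r_def algebra_simps)
      finally show ?case .
    qed
  qed (auto simp: f_def)
  moreover have "(LINT t|M. (\<Sum>k<n. f k t)) = (\<Sum>k<n. integral\<^sup>L M (f k))" for n
    by (rule Bochner_Integration.integral_sum) (rule int)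
  ultimately show ?thesis
    by (simp add: sums_def laplace_def lf)
qed

text \<open>The expansion about a real centre \<open>c\<close> converges in the disc that nearly
  touches the line of abscissa \<open>\<beta>\<close>; as \<open>c\<close> grows, these discs
  exhaust the half-plane.\<close>

lemma laplace_holomorphic:
  assumes "\<And>x. x > \<beta> \<Longrightarrow> laplace_finite M x"
  shows "laplace M holomorphic_on {s. Re s > \<beta>}"
proof -
  have *: "laplace M holomorphic_on ball (of_real c) (c - b)" if "\<beta> < b" "b < c" for b c
    by (rule power_series_holomorphic, rule laplace_sums)
       (use that assms in \<open>auto simp: dist_norm norm_minus_commute\<close>)
  have "laplace M field_differentiable at s" if s: "Re s > \<beta>" for s
  proof -
    define b where "b = (\<beta> + Re s) / 2"
    define d where "d = Re s - b"
    have d: "d > 0" using s by (simp add: d_def b_def field_simps)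
    \<comment> \<open>Chosen so that \<open>s\<close> is closer to \<open>c\<close> than
      \<open>b\<close> is: with \<open>y = (Im s)\<^sup>2 / d\<close> the squared distances are
      \<open>y\<^sup>2 + y * d\<close> and \<open>(y + d)\<^sup>2\<close>.\<close>
    define c where "c = Re s + (Im s)\<^sup>2 / d"
    have "Im s ^ 2 / d \<ge> 0" using d by simp
    have "Im s ^ 2 = Im s ^ 2 / d * d" using d by simp
    hence "(norm (s - of_real c))\<^sup>2 = (Im s ^ 2 / d) ^ 2 + Im s ^ 2 / d * d"
      by (simp add: cmod_power2 c_def)
    also have "\<dots> < (Im s ^ 2 / d + d) ^ 2"
    proof -
      have "0 \<le> Im s ^ 2 / d * d" "d ^ 2 > 0" using d by auto
      thus ?thesis unfolding power2_sum by linarith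
    qed
    finally have "norm (s - of_real c) < Im s ^ 2 / d + d"
      by (rule power_less_imp_less_base) (use d in auto)
    hence "s \<in> ball (of_real c) (c - b)"
      by (simp add: dist_norm norm_minus_commute c_def d_def)
    moreover have "\<beta> < b" using s by (simp add: b_def)
    moreover have "b < c" using d \<open>Im s ^ 2 / d \<ge> 0\<close> c_def d_def by linarith
    ultimately show ?thesis using * holomorphic_on_imp_differentiable_at open_ball by blast
  qed
  thus ?thesis
    unfolding holomorphic_on_def by (auto intro: field_differentiable_at_within)
qed

text \<open>Positivity enters here. The expansion of \<open>exp (r * t)\<close> has nonnegative
  terms, so sum and integral may be exchanged in \<open>ennreal\<close> before anything is known to
  be finite.\<close>

lemma laplace_finite_of_summable_moments:
  assumes "laplace_finite M b" "b < c" "r \<ge> 0" "summable (\<lambda>k. laplace_moment M c k * r ^ k)"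
  shows "laplace_finite M (c - r)"
proof -
  have m0: "laplace_moment M c k \<ge> 0" for k
    unfolding laplace_moment_def by (rule Bochner_Integration.integral_nonneg_AE) (use nonneg_M in eventually_elim, auto)
  have t0: "AE t in M. 0 \<le> t ^ k / fact k * exp (- c * t) * r ^ k" for k
    using nonneg_M by eventually_elim (use assms in auto)
  have "(\<integral>\<^sup>+t. ennreal (exp (- (c - r) * t)) \<partial>M)
      = (\<integral>\<^sup>+t. (\<Sum>k. ennreal (t ^ k / fact k * exp (- c * t) * r ^ k)) \<partial>M)"
  proof (rule nn_integral_cong_AE, use nonneg_M in eventually_elim)
    case (elim t)
    have "(\<lambda>k. exp (- c * t) * ((r * t) ^ k /\<^sub>R fact k)) sums (exp (- c * t) * exp (r * t))"
      by (intro sums_mult exp_converges)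
    also have "exp (- c * t) * exp (r * t) = exp (- (c - r) * t)"
      by (simp add: exp_add [symmetric] algebra_simps)
    also have "(\<lambda>k. exp (- c * t) * ((r * t) ^ k /\<^sub>R fact k)) = (\<lambda>k. t ^ k / fact k * exp (- c * t) * r ^ k)"
      by (simp add: fun_eq_iff power_mult_distrib field_simps)
    finally show ?case using elim assms
      by (subst suminf_ennreal2) (auto simp: sums_iff)
  qed
  also have "\<dots> = (\<Sum>k. \<integral>\<^sup>+t. ennreal (t ^ k / fact k * exp (- c * t) * r ^ k) \<partial>M)"
    by (rule nn_integral_suminf) auto
  also have "\<dots> = (\<Sum>k. ennreal (laplace_moment M c k * r ^ k))"
    unfolding laplace_moment_def using t0 moment_integrable[OF assms(1,2)]
    by (subst nn_integral_eq_integral) (auto intro!: integrable_mult_left simp del: times_divide_eq_left)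
  also have "\<dots> < \<infinity>"
    using m0 assms by (subst suminf_ennreal2) auto
  finally show ?thesis unfolding laplace_finite_def .
qed

text \<open>The Taylor series of \<open>\<Phi>\<close> at \<open>c\<close> has the signed moments as
  coefficients and converges in the whole disc. At the point \<open>c - r\<close> the signs cancel
  against those of \<open>(- r) ^ k\<close>, so the moments themselves are summable against
  \<open>r ^ k\<close>.\<close>

lemma laplace_finite_extend:
  assumes fin: "laplace_finite M b" "b < c" and hol: "\<Phi> holomorphic_on ball (of_real c) \<rho>"
    and ev: "eventually (\<lambda>s. laplace M s = \<Phi> s) (nhds (of_real c))" and r: "0 \<le> r" "r < \<rho>"
  shows "laplace_finite M (c - r)"
proof -
  obtain e where e: "e > 0" "\<And>s. s \<in> ball (of_real c) e \<Longrightarrow> laplace M s = \<Phi> s"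
    using ev by (auto simp: eventually_nhds_metric dist_commute)
  define d where "d = min e (min \<rho> (c - b))"
  have d: "d > 0" using e r fin by (auto simp: d_def)
  define A where "A n = (deriv ^^ n) \<Phi> (of_real c) / fact n" for n
  have s1: "(\<lambda>n. A n * (w - of_real c) ^ n) sums \<Phi> w" if "w \<in> ball (of_real c) \<rho>" for w
    using holomorphic_power_series[OF hol that] by (simp add: A_def)
  have "A = (\<lambda>k. (-1) ^ k * of_real (laplace_moment M c k))"
  proof (rule power_series_coeff_unique[OF d])
    fix w assume w: "w \<in> ball (complex_of_real c) d"
    show "(\<lambda>n. A n * (w - of_real c) ^ n) sums \<Phi> w" using w by (intro s1) (auto simp: d_def)
    show "(\<lambda>k. ((-1) ^ k * of_real (laplace_moment M c k)) * (w - of_real c) ^ k) sums \<Phi> w"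
      using laplace_sums[OF fin, of w] e(2)[of w] w by (auto simp: d_def dist_norm norm_minus_commute)
  qed
  hence S: "(\<lambda>k. ((-1) ^ k * of_real (laplace_moment M c k)) * ((of_real c - of_real r) - of_real c) ^ k)
           sums \<Phi> (of_real c - of_real r)"
    using s1[of "of_real c - of_real r"] r by (simp add: dist_norm)
  have "summable (\<lambda>k. complex_of_real (laplace_moment M c k * r ^ k))"
  proof -
    have eq: "(-1) ^ k * of_real (laplace_moment M c k) * ((of_real c - of_real r) - of_real c) ^ k
            = complex_of_real (laplace_moment M c k * r ^ k)" for k
      using power_mult_distrib[of "-1" "- complex_of_real r" k] by simp
    show ?thesis using sums_summable[OF S] unfolding eq .
  qed
  hence "summable (\<lambda>k. laplace_moment M c k * r ^ k)"
    by (simp only: summable_of_real_iff)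
  thus ?thesis using laplace_finite_of_summable_moments[OF fin r(1)] by simp
qed

text \<open>Were the abscissa of convergence \<open>\<beta>\<close> positive, \<open>\<Phi>\<close>
  would be holomorphic around the real point \<open>\<beta>\<close>, and a disc centred slightly to
  its right would carry convergence past \<open>\<beta>\<close>.\<close>

lemma landau:
  fixes \<Phi> :: "complex \<Rightarrow> complex" and P :: "complex set"
  defines "D \<equiv> {s. Re s > 0} - P"
  assumes P: "countable P" "open D" "\<And>x. x > 0 \<Longrightarrow> of_real x \<notin> P"
    and hol: "\<Phi> holomorphic_on D"
    and fin: "\<And>x. x > b \<Longrightarrow> laplace_finite M x"
    and eq: "\<And>x. x > b \<Longrightarrow> laplace M (of_real x) = \<Phi> (of_real x)"
  shows "laplace M holomorphic_on {s. Re s > 0}" "\<And>s. s \<in> D \<Longrightarrow> laplace M s = \<Phi> s"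
proof -
  \<comment> \<open>Stated for any \<open>\<beta>\<close> because it is applied to the still unknown
    abscissa and then to \<open>0\<close>. The identity theorem applies since an open half-plane
    stays connected after removal of a countable set, and both functions agree on a real
    ray.\<close>
  have agree: "laplace M s = \<Phi> s"
    if \<beta>: "\<beta> \<ge> 0" "\<And>x. x > \<beta> \<Longrightarrow> laplace_finite M x" and s: "s \<in> D" "Re s > \<beta>" for s \<beta>
  proof -
    let ?S = "{s. Re s > \<beta>} - P"
    define q where "q = max \<beta> b"
    have S: "?S = D \<inter> {s. Re s > \<beta>}" using \<beta>(1) by (auto simp: D_def)
    have "laplace M s - \<Phi> s = 0"
    proof (rule analytic_continuation[where f = "\<lambda>s. laplace M s - \<Phi> s" and w = s and S = ?S and U = "of_real ` {q<..}" and \<xi> = "of_real (q + 1)"])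
      show "(\<lambda>s. laplace M s - \<Phi> s) holomorphic_on ?S"
        by (intro holomorphic_on_diff holomorphic_on_subset[OF laplace_holomorphic[OF \<beta>(2)]]
              holomorphic_on_subset[OF hol]) (auto simp: S)
      show "open ?S" unfolding S by (intro open_Int P open_halfspace_Re_gt)
      show "connected ?S"
        by (intro connected_open_diff_countable P open_halfspace_Re_gt convex_connected convex_halfspace_Re_gt) auto
      show "complex_of_real ` {q<..} \<subseteq> ?S" using P(3) \<beta>(1) by (auto simp: q_def)
      show "complex_of_real (q + 1) \<in> ?S" using P(3)[of "q + 1"] \<beta>(1) by (auto simp: q_def)
      show "complex_of_real (q + 1) islimpt of_real ` {q<..}"
      proof (rule islimptI)
        fix T assume T: "complex_of_real (q + 1) \<in> T" "open T"
        then obtain e where e: "e > 0" "ball (complex_of_real (q + 1)) e \<subseteq> T" by (meson openE)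
        have "complex_of_real (q + 1 + e / 2) \<in> ball (complex_of_real (q + 1)) e"
          using e by (simp add: dist_norm)
        thus "\<exists>y\<in>of_real ` {q<..}. y \<in> T \<and> y \<noteq> complex_of_real (q + 1)"
          using e by (intro bexI[of _ "complex_of_real (q + 1 + e / 2)"] conjI imageI) auto
      qed
      show "s \<in> ?S" using s by (simp add: S)
    qed (auto simp: q_def eq)
    thus ?thesis by simp
  qed
  define S where "S = {x. x > 0 \<and> laplace_finite M x}"
  define \<beta> where "\<beta> = Inf S"
  have "max 0 b + 1 \<in> S" using fin[of "max 0 b + 1"] by (simp add: S_def)
  hence ne: "S \<noteq> {}" by blast
  have bdd: "bdd_below S" by (rule bdd_belowI[of _ 0]) (auto simp: S_def)
  have \<beta>0: "\<beta> \<ge> 0" unfolding \<beta>_def using ne by (rule cInf_greatest) (auto simp: S_def)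
  have \<beta>fin: "laplace_finite M x" if x: "x > \<beta>" for x
  proof -
    obtain y where "y \<in> S" "y < x" using cInf_less_iff[OF ne bdd] x by (auto simp: \<beta>_def)
    thus ?thesis using laplace_finite_mono[of y x] by (auto simp: S_def)
  qed
  have "\<beta> = 0"
  proof (rule ccontr)
    assume "\<beta> \<noteq> 0"
    hence "of_real \<beta> \<in> D" using \<beta>0 P(3)[of \<beta>] by (auto simp: D_def)
    then obtain e where e: "e > 0" "ball (of_real \<beta>) e \<subseteq> D" using P(2) by (meson openE)
    \<comment> \<open>The disc stays inside the ball of radius \<open>e\<close> about
      \<open>\<beta>\<close>, and \<open>c - 3 / 4 * \<rho>\<close> equals
      \<open>\<beta> - e / 8\<close>, a point to the left of \<open>\<beta>\<close>.\<close>
    define \<rho> c where "\<rho> = e / 2" and "c = \<beta> + e / 4"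
    have sub: "ball (of_real c) \<rho> \<subseteq> ball (complex_of_real \<beta>) e"
    proof
      fix x assume "x \<in> ball (complex_of_real c) \<rho>"
      moreover have "dist (complex_of_real \<beta>) (of_real c) = e / 4" using e(1)
        by (simp add: c_def dist_norm)
      ultimately show "x \<in> ball (complex_of_real \<beta>) e"
        using dist_triangle[of "complex_of_real \<beta>" x "of_real c"] e(1) by (simp add: \<rho>_def)
    qed
    have "laplace_finite M (c - 3 / 4 * \<rho>)"
    proof (rule laplace_finite_extend[where b = "\<beta> + e / 8"])
      show "laplace_finite M (\<beta> + e / 8)" using e by (intro \<beta>fin) auto
      show "\<Phi> holomorphic_on ball (of_real c) \<rho>"
        using sub e(2) by (intro holomorphic_on_subset[OF hol]) auto
      have "open (D \<inter> {s. Re s > \<beta>})" by (intro open_Int P open_halfspace_Re_gt)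
      moreover have "of_real c \<in> ball (complex_of_real c) \<rho>" using e by (simp add: \<rho>_def)
      hence "of_real c \<in> D" using sub e by blast
      hence "of_real c \<in> D \<inter> {s. Re s > \<beta>}" using e by (simp add: c_def)
      ultimately show "eventually (\<lambda>s. laplace M s = \<Phi> s) (nhds (of_real c))"
        unfolding eventually_nhds using agree[OF \<beta>0 \<beta>fin] by blast
    qed (use e in \<open>auto simp: c_def \<rho>_def\<close>)
    \<comment> \<open>Membership in \<open>D\<close> shows that this point is still positive, as
      \<open>S\<close> demands.\<close>
    moreover have "of_real (c - 3 / 4 * \<rho>) \<in> ball (complex_of_real c) \<rho>"
      using e(1) by (simp add: dist_norm \<rho>_def)
    hence "of_real (c - 3 / 4 * \<rho>) \<in> D" using sub e(2) by blast
    ultimately have "c - 3 / 4 * \<rho> \<in> S" by (auto simp: S_def D_def)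
    hence "\<beta> \<le> c - 3 / 4 * \<rho>" unfolding \<beta>_def using bdd by (rule cInf_lower)
    thus False using e(1) by (simp add: c_def \<rho>_def)
  qed
  thus "laplace M holomorphic_on {s. Re s > 0}" "\<And>s. s \<in> D \<Longrightarrow> laplace M s = \<Phi> s"
    using laplace_holomorphic[of 0] agree[of 0] \<beta>fin by (auto simp: D_def)
qed

end

section \<open>Sums of partial fractions and oscillating sums\<close>

text \<open>Absolute integrability comes from the real exponential
  \<open>exp (- Re \<zeta> * t)\<close>; the complex value is then the limit of the integrals over
  \<open>{0..y}\<close>.\<close>

lemma has_bochner_integral_exp_Ici:
  fixes \<zeta> :: complex assumes "Re \<zeta> > 0"
  shows "has_bochner_integral lborel (\<lambda>t. indicator {0..} t *\<^sub>R exp (- \<zeta> * of_real t)) (1 / \<zeta>)"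
proof -
  let ?f = "\<lambda>t::real. exp (- \<zeta> * of_real t)"
  have nn: "(\<integral>\<^sup>+x\<in>{0..}. ennreal (exp (- Re \<zeta> * x)) \<partial>lborel) = ennreal (0 - - exp (- Re \<zeta> * 0) / Re \<zeta>)"
    using assms
    by (intro nn_integral_FTC_atLeast[where F = "\<lambda>x. - exp (- Re \<zeta> * x) / Re \<zeta>"])
       (auto intro!: derivative_eq_intros, real_asymp)
  have int: "integrable lborel (\<lambda>t. indicator {0..} t *\<^sub>R ?f t)"
  proof (rule integrableI_bounded)
    have "(\<integral>\<^sup>+t. ennreal (norm (indicator {0..} t *\<^sub>R ?f t)) \<partial>lborel)
            = (\<integral>\<^sup>+x\<in>{0..}. ennreal (exp (- Re \<zeta> * x)) \<partial>lborel)"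
      by (intro nn_integral_cong) (auto simp: indicator_def)
    thus "(\<integral>\<^sup>+t. ennreal (norm (indicator {0..} t *\<^sub>R ?f t)) \<partial>lborel) < \<infinity>" unfolding nn by simp
  qed auto
  have "((\<lambda>y. LINT t|lborel. indicator {..y} t *\<^sub>R (indicator {0..} t *\<^sub>R ?f t)) \<longlongrightarrow>
          (LINT t|lborel. indicator {0..} t *\<^sub>R ?f t)) at_top"
    by (rule tendsto_integral_at_top) (use int in auto)
  moreover have "((\<lambda>y. LINT t|lborel. indicator {..y} t *\<^sub>R (indicator {0..} t *\<^sub>R ?f t)) \<longlongrightarrow> 1 / \<zeta>) at_top"
  proof (rule Lim_transform_eventually)
    have "((\<lambda>y::real. exp (- Re \<zeta> * y)) \<longlongrightarrow> 0) at_top"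
      using assms by real_asymp
    hence "((\<lambda>y::real. exp (- Re \<zeta> * y) / norm \<zeta>) \<longlongrightarrow> 0) at_top"
      by (rule tendsto_divide_zero)
    hence "((\<lambda>y::real. - ?f y / \<zeta>) \<longlongrightarrow> 0) at_top"
      by (subst tendsto_norm_zero_iff [symmetric]) (simp add: norm_divide)
    hence "((\<lambda>y::real. - ?f y / \<zeta> - (- 1 / \<zeta>)) \<longlongrightarrow> 0 - (- 1 / \<zeta>)) at_top"
      by (intro tendsto_intros)
    thus "((\<lambda>y::real. - ?f y / \<zeta> - (- 1 / \<zeta>)) \<longlongrightarrow> 1 / \<zeta>) at_top" by simp
    show "\<forall>\<^sub>F y in at_top. - ?f y / \<zeta> - (- 1 / \<zeta>) =
            (LINT t|lborel. indicator {..y} t *\<^sub>R (indicator {0..} t *\<^sub>R ?f t))"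
      using eventually_ge_at_top[of 0]
    proof eventually_elim
      case (elim y)
      have "(LINT t|lborel. indicator {0..y} t *\<^sub>R ?f t) = - ?f y / \<zeta> - - ?f 0 / \<zeta>"
      proof (rule integral_FTC_Icc[OF elim])
        fix x :: real
        have "((\<lambda>s. - exp (- \<zeta> * s) / \<zeta>) has_field_derivative ?f x) (at (of_real x))"
          using assms by (auto intro!: derivative_eq_intros)
        thus "((\<lambda>x. - ?f x / \<zeta>) has_vector_derivative ?f x) (at x within {0..y})"
          using has_vector_derivative_real_field has_vector_derivative_at_within by blast
      qed (auto intro!: continuous_intros)
      moreover have "(\<lambda>t. indicator {..y} t *\<^sub>R (indicator {0..} t *\<^sub>R ?f t)) = (\<lambda>t. indicator {0..y} t *\<^sub>R ?f t)"
        by (auto simp: indicator_def fun_eq_iff)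
      ultimately show ?case by simp
    qed
  qed
  ultimately have "(LINT t|lborel. indicator {0..} t *\<^sub>R ?f t) = 1 / \<zeta>"
    by (rule tendsto_unique[rotated]) simp
  thus ?thesis using int by (simp add: has_bochner_integral_iff)
qed

lemma has_bochner_integral_power2_exp_Ici:
  fixes x :: real assumes "x > 0"
  shows "has_bochner_integral lborel (\<lambda>t. indicator {0..} t * (t\<^sup>2 * exp (- x * t))) (2 / x ^ 3)"
proof (rule has_bochner_integral_nn_integral)
  let ?F = "\<lambda>t. - (t\<^sup>2 / x + 2 * t / x\<^sup>2 + 2 / x ^ 3) * exp (- x * t)"
  have "(\<integral>\<^sup>+t\<in>{0..}. ennreal (t\<^sup>2 * exp (- x * t)) \<partial>lborel) = ennreal (0 - ?F 0)"
  proof (rule nn_integral_FTC_atLeast)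
    show "(?F has_real_derivative t\<^sup>2 * exp (- x * t)) (at t)" for t
      using assms by (auto intro!: derivative_eq_intros simp: field_simps power2_eq_square power3_eq_cube)
    show "(?F \<longlongrightarrow> 0) at_top" using assms by real_asymp
  qed auto
  thus "(\<integral>\<^sup>+t. ennreal (indicator {0..} t * (t\<^sup>2 * exp (- x * t))) \<partial>lborel) = ennreal (2 / x ^ 3)"
    by (subst (asm) nn_integral_cong[where v = "\<lambda>t. ennreal (indicator {0..} t * (t\<^sup>2 * exp (- x * t)))"])
       (auto simp: indicator_def)
qed (use assms in auto)

section \<open>Weighted points and their partial fractions\<close>

text \<open>Models the nonzero ordinates with their multiplicities. Indices that enumerate nothing
  get weight \<open>0\<close> and an arbitrary nonzero point, hence the guards
  \<open>w n \<noteq> 0\<close> throughout.\<close>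

locale weighted_points =
  fixes z :: "nat \<Rightarrow> complex" and w :: "nat \<Rightarrow> real"
  assumes w_nonneg: "w n \<ge> 0" and z_nonzero: "z n \<noteq> 0"
    and summable_w: "summable (\<lambda>n. w n / norm (z n) ^ 2)"
    and locally_finite: "finite {n. w n \<noteq> 0 \<and> norm (z n) \<le> R}"
begin

text \<open>The Laplace transform of \<open>w * (1 - exp (- \<i> * z * t)) / z\<^sup>2\<close> is
  \<open>w / z\<^sup>2\<close> times \<open>1 / s - 1 / (s + \<i> * z)\<close>. This is the result
  with a common factor \<open>1 / s\<close> taken out.\<close>

definition frac_term :: "nat \<Rightarrow> complex \<Rightarrow> complex" where
  "frac_term n s = of_real (w n) * \<i> / (z n * (s + \<i> * z n))"

definition frac_sum :: "complex \<Rightarrow> complex" where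
  "frac_sum s = (\<Sum>n. frac_term n s)"

text \<open>For \<open>\<bar>s\<bar> < R\<close> and \<open>\<bar>z n\<bar> > 2 * R\<close> the
  denominator satisfies \<open>\<bar>s + \<i> * z n\<bar> \<ge> \<bar>z n\<bar> / 2\<close>. So all
  but finitely many terms are dominated by \<open>2 * w n / \<bar>z n\<bar>^2\<close>, and the
  Weierstrass test makes their sum holomorphic.\<close>

lemma frac_sum_decomp:
  fixes R :: real
  defines "N \<equiv> {n. w n \<noteq> 0 \<and> norm (z n) \<le> 2 * R}"
  obtains T where "T holomorphic_on ball 0 R"
    "\<And>s. s \<in> ball 0 R \<Longrightarrow> frac_sum s = (\<Sum>n\<in>N. frac_term n s) + T s"
proof -
  define g where "g n s = (if n \<in> N then 0 else frac_term n s)" for n s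
  define T where "T s = (\<Sum>n. g n s)" for s
  have finN: "finite N" unfolding N_def by (rule locally_finite)
  have bound: "norm (g n s) \<le> 2 * (w n / norm (z n) ^ 2)" if s: "s \<in> ball 0 R" for n s
  proof (cases "n \<in> N \<or> w n = 0")
    case True thus ?thesis using w_nonneg[of n] by (auto simp: g_def frac_term_def)
  next
    case False
    hence zR: "norm (z n) > 2 * R" by (auto simp: N_def)
    have "norm (\<i> * z n) - norm (- s) \<le> norm (\<i> * z n - (- s))" by (rule norm_triangle_ineq2)
    hence le: "norm (z n) / 2 \<le> norm (s + \<i> * z n)"
      using s zR by (simp add: norm_mult algebra_simps)
    have "norm (g n s) = w n / (norm (z n) * norm (s + \<i> * z n))"
      using False w_nonneg[of n] by (simp add: g_def frac_term_def norm_mult norm_divide)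
    also have "\<dots> \<le> w n / (norm (z n) * (norm (z n) / 2))"
      using w_nonneg[of n] z_nonzero[of n] le
      by (intro divide_left_mono mult_left_mono mult_pos_pos) (auto intro!: less_le_trans[OF _ le])
    also have "\<dots> = 2 * (w n / norm (z n) ^ 2)" by (simp add: power2_eq_square)
    finally show ?thesis .
  qed
  have sumb: "summable (\<lambda>n. 2 * (w n / norm (z n) ^ 2))" by (intro summable_mult summable_w)
  have nz: "s + \<i> * z n \<noteq> 0" if "s \<in> ball 0 R" "n \<notin> N" "w n \<noteq> 0" for s n
  proof
    assume "s + \<i> * z n = 0"
    hence "s = - (\<i> * z n)" by (simp add: add_eq_0_iff2)
    hence "norm s = norm (z n)" by (simp add: norm_mult)
    thus False using that norm_ge_zero[of "z n"] by (auto simp: N_def simp del: norm_ge_zero)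
  qed
  have "T holomorphic_on ball 0 R"
  proof (rule holomorphic_uniform_sequence)
    show "(\<lambda>s. \<Sum>i<n. g i s) holomorphic_on ball 0 R" for n
    proof (intro holomorphic_intros)
      fix i
      show "g i holomorphic_on ball 0 R"
      proof (cases "i \<in> N \<or> w i = 0")
        case True
        hence "g i = (\<lambda>_. 0)" by (auto simp: g_def frac_term_def fun_eq_iff)
        thus ?thesis by simp
      next
        case False
        hence "g i = frac_term i" by (auto simp: g_def fun_eq_iff)
        thus ?thesis using nz False z_nonzero[of i] unfolding frac_term_def [abs_def]
          by (auto intro!: holomorphic_intros)
      qed
    qed
    fix s :: complex assume s: "s \<in> ball 0 R"
    then obtain d where d: "d > 0" "cball s d \<subseteq> ball 0 R" by (meson open_ball open_contains_cball)
    have "uniform_limit (cball s d) (\<lambda>n s. \<Sum>i<n. g i s) T sequentially"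
      unfolding T_def by (rule Weierstrass_m_test[OF _ sumb]) (use bound d in blast)
    thus "\<exists>d>0. cball s d \<subseteq> ball 0 R \<and> uniform_limit (cball s d) (\<lambda>n s. \<Sum>i<n. g i s) T sequentially"
      using d by blast
  qed auto
  moreover have "frac_sum s = (\<Sum>n\<in>N. frac_term n s) + T s" if s: "s \<in> ball 0 R" for s
  proof -
    have "(\<lambda>n. g n s) sums T s" unfolding T_def
      using bound[OF s] by (intro summable_sums summable_comparison_test'[OF sumb, of 0]) auto
    hence "(\<lambda>n. (if n \<in> N then frac_term n s else 0) + g n s) sums ((\<Sum>n\<in>N. frac_term n s) + T s)"
      by (intro sums_add sums_If_finite_set finN)
    also have "(\<lambda>n. (if n \<in> N then frac_term n s else 0) + g n s) = (\<lambda>n. frac_term n s)"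
      by (auto simp: g_def)
    finally show ?thesis by (simp add: frac_sum_def sums_iff)
  qed
  ultimately show ?thesis by (rule that)
qed

definition poles :: "complex set" where "poles = {- \<i> * z n |n. w n \<noteq> 0}"

text \<open>Sums over all indices with the same point, as \<open>z\<close> is not assumed injective.
  The value is \<open>0\<close> off \<open>poles\<close>, which lets the residue formula hold at
  every nonzero \<open>p\<close>.\<close>

definition pole_weight :: "complex \<Rightarrow> real" where
  "pole_weight p = (\<Sum>n | w n \<noteq> 0 \<and> - \<i> * z n = p. w n)"

lemma countable_poles: "countable poles"
  unfolding poles_def by (simp add: setcompr_eq_image)

lemma finite_poles: "finite {n. w n \<noteq> 0 \<and> - \<i> * z n = p}"
  by (rule finite_subset[OF _ locally_finite[of "norm p"]]) (auto simp: norm_mult)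

lemma not_islimpt_poles: "\<not> x islimpt poles"
proof -
  have fin: "finite (poles \<inter> cball 0 R)" for R
  proof -
    have "poles \<inter> cball 0 R \<subseteq> (\<lambda>n. - \<i> * z n) ` {n. w n \<noteq> 0 \<and> norm (z n) \<le> R}"
      by (auto simp: poles_def norm_mult)
    thus ?thesis using locally_finite finite_surj by blast
  qed
  show ?thesis
  proof
    assume x: "x islimpt poles"
    have "eventually (\<lambda>y. y \<in> ball 0 (norm x + 1)) (at x)"
      by (rule eventually_at_in_open') auto
    hence "x islimpt (poles \<inter> ball 0 (norm x + 1))"
      using x by (intro islimpt_Int_eventually)
    moreover have "finite (poles \<inter> ball 0 (norm x + 1))"
      by (rule finite_subset[OF _ fin[of "norm x + 1"]]) auto
    ultimately show False by (simp add: islimpt_finite)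
  qed
qed

lemma closed_poles: "closed poles"
  using not_islimpt_poles by (simp add: closed_limpt)

lemma frac_term_holomorphic: "frac_term n holomorphic_on - poles"
proof (cases "w n = 0")
  case True thus ?thesis by (simp add: frac_term_def [abs_def])
next
  case False
  have "s + \<i> * z n \<noteq> 0" if "s \<in> - poles" for s
    using that False by (auto simp: poles_def add_eq_0_iff2)
  thus ?thesis unfolding frac_term_def [abs_def]
    using z_nonzero[of n] by (auto intro!: holomorphic_intros)
qed

lemma frac_sum_holomorphic: "frac_sum holomorphic_on - poles"
proof -
  have "frac_sum field_differentiable at s" if s: "s \<notin> poles" for s
  proof -
    define R where "R = norm s + 1"
    obtain T where T: "T holomorphic_on ball 0 R"
      "\<And>s. s \<in> ball 0 R \<Longrightarrow> frac_sum s = (\<Sum>n | w n \<noteq> 0 \<and> norm (z n) \<le> 2 * R. frac_term n s) + T s"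
      using frac_sum_decomp by blast
    have o: "open (ball 0 R - poles)" using closed_poles by blast
    have "(\<lambda>s. (\<Sum>n | w n \<noteq> 0 \<and> norm (z n) \<le> 2 * R. frac_term n s) + T s) holomorphic_on ball 0 R - poles"
      by (intro holomorphic_intros holomorphic_on_subset[OF T(1)] holomorphic_on_subset[OF frac_term_holomorphic]) auto
    hence "frac_sum holomorphic_on ball 0 R - poles"
      by (rule holomorphic_transform) (use T(2) in auto)
    thus ?thesis using o s holomorphic_on_imp_differentiable_at by (auto simp: R_def)
  qed
  thus ?thesis unfolding holomorphic_on_def by (auto intro: field_differentiable_at_within)
qed

text \<open>For \<open>z n = \<i> * p\<close> the term is \<open>w n / (p * (s - p))\<close>. All
  contributions at \<open>p\<close> are thus nonnegative multiples of \<open>1 / p\<close>, the fact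
  that later excludes cancellation.\<close>

lemma frac_sum_residue:
  assumes "p \<noteq> 0"
  shows "((\<lambda>s. (s - p) * frac_sum s) \<longlongrightarrow> of_real (pole_weight p) / p) (at p)"
proof -
  define R where "R = norm p + 1"
  define N where "N = {n. w n \<noteq> 0 \<and> norm (z n) \<le> 2 * R}"
  obtain T where T: "T holomorphic_on ball 0 R"
    "\<And>s. s \<in> ball 0 R \<Longrightarrow> frac_sum s = (\<Sum>n\<in>N. frac_term n s) + T s"
    using frac_sum_decomp unfolding N_def by blast
  have finN: "finite N" unfolding N_def by (rule locally_finite)
  define c where "c n = (if - \<i> * z n = p then of_real (w n) / p else 0)" for n
  have pR: "p \<in> ball 0 R" by (simp add: R_def)
  have lim: "((\<lambda>s. (s - p) * frac_term n s) \<longlongrightarrow> c n) (at p)" for n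
  proof (cases "- \<i> * z n = p")
    case True
    hence z: "z n = \<i> * p" by (auto simp: mult.assoc [symmetric])
    have "eventually (\<lambda>s. s \<noteq> p) (at p)" by (simp add: eventually_at_filter)
    hence "eventually (\<lambda>s. c n = (s - p) * frac_term n s) (at p)"
      by eventually_elim (use assms in \<open>simp add: True c_def frac_term_def, simp add: z\<close>)
    thus ?thesis by (rule Lim_transform_eventually[OF tendsto_const])
  next
    case False
    have "((\<lambda>s. (s - p) * frac_term n s) \<longlongrightarrow> (p - p) * frac_term n p) (at p)"
      unfolding frac_term_def using False z_nonzero[of n]
      by (intro tendsto_intros) (auto simp: add_eq_0_iff2)
    thus ?thesis using False by (simp add: c_def)
  qed
  have "isCont T p"
    using T(1) pR continuous_on_eq_continuous_at holomorphic_on_imp_continuous_on open_ball by blast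
  hence "((\<lambda>s. (\<Sum>n\<in>N. (s - p) * frac_term n s) + (s - p) * T s) \<longlongrightarrow> (\<Sum>n\<in>N. c n) + (p - p) * T p) (at p)"
    by (intro tendsto_intros lim) (auto simp: isCont_def)
  moreover have "(\<Sum>n\<in>N. c n) = of_real (pole_weight p) / p"
  proof -
    have "(\<Sum>n\<in>N. c n) = (\<Sum>n | w n \<noteq> 0 \<and> - \<i> * z n = p. of_real (w n) / p)"
      by (rule sum.mono_neutral_cong_right) (use finN in \<open>auto simp: N_def c_def R_def norm_mult\<close>)
    thus ?thesis by (simp add: pole_weight_def sum_divide_distrib)
  qed
  moreover have "\<forall>\<^sub>F s in at p. (\<Sum>n\<in>N. (s - p) * frac_term n s) + (s - p) * T s = (s - p) * frac_sum s"
    using eventually_at_in_open'[OF open_ball pR]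
    by eventually_elim (simp add: T(2) sum_distrib_left distrib_left)
  ultimately show ?thesis by (auto intro: Lim_transform_eventually)
qed

section \<open>Oscillating sums and their Laplace transforms\<close>

definition osc_term :: "nat \<Rightarrow> real \<Rightarrow> complex" where
  "osc_term n t = of_real (w n) * (1 - exp (- \<i> * z n * of_real t)) / z n ^ 2"

lemma norm_osc_term_le:
  assumes "w n \<noteq> 0 \<Longrightarrow> \<bar>Im (z n)\<bar> \<le> b" "b \<ge> 0" "t \<ge> 0"
  shows "norm (osc_term n t) \<le> 2 * exp (b * t) * (w n / norm (z n) ^ 2)"
proof (cases "w n = 0")
  case False
  have "norm (1 - exp (- \<i> * z n * of_real t)) \<le> 1 + exp (Im (z n) * t)"
    by (rule norm_triangle_ineq4[THEN order_trans]) simp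
  also have "Im (z n) * t \<le> b * t" using assms(1)[OF False] assms(3) by (intro mult_right_mono) auto
  hence "1 + exp (Im (z n) * t) \<le> exp (b * t) + exp (b * t)"
    using assms by (intro add_mono) auto
  finally have "norm (1 - exp (- \<i> * z n * of_real t)) \<le> 2 * exp (b * t)" by simp
  hence "w n / norm (z n) ^ 2 * norm (1 - exp (- \<i> * z n * of_real t)) \<le> w n / norm (z n) ^ 2 * (2 * exp (b * t))"
    using w_nonneg by (intro mult_left_mono) auto
  thus ?thesis using w_nonneg[of n]
    by (simp add: osc_term_def norm_mult norm_divide norm_power mult_ac)
qed (simp add: osc_term_def)

lemma has_bochner_integral_osc_term:
  assumes "w n \<noteq> 0 \<Longrightarrow> \<bar>Im (z n)\<bar> \<le> b" "b \<ge> 0" "x > b"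
  shows "has_bochner_integral lborel (\<lambda>t. indicator {0..} t *\<^sub>R (osc_term n t * of_real (exp (- x * t))))
           (frac_term n (of_real x) / of_real x)"
proof (cases "w n = 0")
  case True
  thus ?thesis by (simp add: osc_term_def frac_term_def has_bochner_integral_zero)
next
  case False
  define c where "c = of_real (w n) / z n ^ 2"
  have x: "x > 0" "Re (of_real x + \<i> * z n) > 0" using assms False by auto
  have nz: "of_real x + \<i> * z n \<noteq> 0" using x by force
  have "has_bochner_integral lborel (\<lambda>t. c * (indicator {0..} t *\<^sub>R exp (- of_real x * complex_of_real t)
           - indicator {0..} t *\<^sub>R exp (- (of_real x + \<i> * z n) * of_real t)))
           (c * (1 / of_real x - 1 / (of_real x + \<i> * z n)))"
    by (intro has_bochner_integral_mult_right has_bochner_integral_diff has_bochner_integral_exp_Ici) (use x in auto)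
  also have "(\<lambda>t. c * (indicator {0..} t *\<^sub>R exp (- of_real x * complex_of_real t)
           - indicator {0..} t *\<^sub>R exp (- (of_real x + \<i> * z n) * of_real t)))
        = (\<lambda>t. indicator {0..} t *\<^sub>R (osc_term n t * of_real (exp (- x * t))))"
    by (auto simp: fun_eq_iff c_def osc_term_def exp_of_real [symmetric] exp_add [symmetric]
        indicator_def algebra_simps diff_divide_distrib)
  also have "c * (1 / of_real x - 1 / (of_real x + \<i> * z n)) = frac_term n (of_real x) / of_real x"
    using x nz z_nonzero[of n] by (simp add: c_def frac_term_def field_simps power2_eq_square)
  finally show ?thesis .
qed

text \<open>Sum and integral are exchanged because every term is dominated by
  \<open>w n / \<bar>z n\<bar>^2\<close> times one integrable function, a multiple of
  \<open>exp (- (x - b) * t)\<close> on the half-line.\<close>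

lemma has_bochner_integral_osc_sum:
  assumes "\<And>n. w n \<noteq> 0 \<Longrightarrow> \<bar>Im (z n)\<bar> \<le> b" "b \<ge> 0" "x > b"
  shows "has_bochner_integral lborel (\<lambda>t. indicator {0..} t *\<^sub>R ((\<Sum>n. osc_term n t) * of_real (exp (- x * t))))
           (frac_sum (of_real x) / of_real x)"
proof -
  define f where "f n t = indicator {0..} t *\<^sub>R (osc_term n t * of_real (exp (- x * t)))" for n t
  have f: "has_bochner_integral lborel (f n) (frac_term n (of_real x) / of_real x)" for n
    unfolding f_def by (rule has_bochner_integral_osc_term) (use assms in auto)
  note fint = f[THEN integrable.intros]
  have fb: "norm (f n t) \<le> w n / norm (z n) ^ 2 * (2 * (indicator {0..} t * exp (- (x - b) * t)))" for n t
  proof (cases "t \<ge> 0")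
    case True
    have "norm (f n t) = norm (osc_term n t) * exp (- x * t)"
      using True by (simp add: f_def norm_mult)
    also have "\<dots> \<le> 2 * exp (b * t) * (w n / norm (z n) ^ 2) * exp (- x * t)"
      by (intro mult_right_mono norm_osc_term_le) (use assms True in auto)
    also have "\<dots> = w n / norm (z n) ^ 2 * (2 * exp (- (x - b) * t))"
      by (simp add: exp_add [symmetric] algebra_simps exp_diff exp_minus field_simps)
    finally show ?thesis using True by simp
  qed (simp add: f_def)
  have gint: "integrable lborel (\<lambda>t. w n / norm (z n) ^ 2 * (2 * (indicator {0..} t * exp (- (x - b) * t))))" for n
  proof -
    have "has_bochner_integral lborel (\<lambda>t. indicator {0..} t *\<^sub>R exp (- complex_of_real (x - b) * of_real t)) (1 / of_real (x - b))"
      by (rule has_bochner_integral_exp_Ici) (use assms in auto)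
    hence "integrable lborel (\<lambda>t. norm (indicator {0..} t *\<^sub>R exp (- complex_of_real (x - b) * of_real t)))"
      by (intro integrable_norm integrable.intros)
    also have "(\<lambda>t. norm (indicator {0..} t *\<^sub>R exp (- complex_of_real (x - b) * of_real t)))
              = (\<lambda>t. indicator {0..} t * exp (- (x - b) * t))"
      by (auto simp: indicator_def fun_eq_iff)
    finally show ?thesis by (intro integrable_mult_right)
  qed
  have sn: "summable (\<lambda>n. w n / norm (z n) ^ 2 * y)" for y by (intro summable_mult2 summable_w)
  have s1: "AE t in lborel. summable (\<lambda>n. norm (f n t))"
    using fb by (intro AE_I2 summable_comparison_test'[OF sn, of 0]) auto
  have s2: "summable (\<lambda>n. LINT t|lborel. norm (f n t))"
  proof (rule summable_comparison_test'[OF sn, of 0])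
    fix n
    have "(LINT t|lborel. norm (f n t))
        \<le> (LINT t|lborel. w n / norm (z n) ^ 2 * (2 * (indicator {0..} t * exp (- (x - b) * t))))"
      by (intro integral_mono integrable_norm fint gint fb)
    also have "\<dots> = w n / norm (z n) ^ 2 * (LINT t|lborel. 2 * (indicator {0..} t * exp (- (x - b) * t)))"
      by simp
    finally show "norm (LINT t|lborel. norm (f n t)) \<le> \<dots>" by simp
  qed
  have "(LINT t|lborel. (\<Sum>n. f n t)) = (\<Sum>n. integral\<^sup>L lborel (f n))"
    by (intro integral_suminf fint s1 s2)
  also have "\<dots> = (\<Sum>n. frac_term n (of_real x) / of_real x)"
    using f by (simp add: has_bochner_integral_iff)
  also have "\<dots> = frac_sum (of_real x) / of_real x"
  proof -
    have "(\<lambda>n. integral\<^sup>L lborel (f n)) sums (LINT t|lborel. (\<Sum>n. f n t))"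
      by (intro sums_integral fint s1 s2)
    hence "summable (\<lambda>n. frac_term n (of_real x) / of_real x)"
      using f by (simp add: has_bochner_integral_iff sums_iff)
    hence "summable (\<lambda>n. frac_term n (of_real x) / of_real x * of_real x)"
      by (rule summable_mult2)
    hence "summable (\<lambda>n. frac_term n (of_real x))" using assms by simp
    thus ?thesis unfolding frac_sum_def by (rule suminf_divide)
  qed
  finally have "has_bochner_integral lborel (\<lambda>t. \<Sum>n. f n t) (frac_sum (of_real x) / of_real x)"
    by (simp add: has_bochner_integral_iff integrable_suminf fint s1 s2)
  also have "(\<lambda>t. \<Sum>n. f n t) = (\<lambda>t. indicator {0..} t *\<^sub>R ((\<Sum>n. osc_term n t) * of_real (exp (- x * t))))"
  proof
    fix t
    show "(\<Sum>n. f n t) = indicator {0..} t *\<^sub>R ((\<Sum>n. osc_term n t) * of_real (exp (- x * t)))"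
    proof (cases "t \<ge> 0")
      case True
      have "summable (\<lambda>n. osc_term n t)"
        by (rule summable_comparison_test'[OF summable_mult[OF summable_w, of "2 * exp (b * t)"], of 0])
           (use norm_osc_term_le[OF assms(1,2) True] in auto)
      thus ?thesis using True by (simp add: f_def suminf_mult2)
    qed (simp add: f_def)
  qed
  finally show ?thesis .
qed

text \<open>The bound \<open>b\<close> provides a half-plane where the transform converges to begin
  with. The hypothesis \<open>imag\<close> keeps the points \<open>- \<i> * z n\<close> and their
  conjugates off the real axis, which is what \<open>landau\<close> requires of the exceptional
  set.\<close>

lemma nonneg_imp_Im_nonpos:
  assumes b: "\<And>n. w n \<noteq> 0 \<Longrightarrow> \<bar>Im (z n)\<bar> \<le> b" "b \<ge> 0"
    and imag: "\<And>n. w n \<noteq> 0 \<Longrightarrow> Re (z n) \<noteq> 0"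
    and nonneg: "\<And>t. t \<ge> t0 \<Longrightarrow> c * t\<^sup>2 + Re (\<Sum>n. osc_term n t) \<ge> 0"
    and m: "w m \<noteq> 0"
  shows "Im (z m) \<le> 0"
proof (rule ccontr)
  assume "\<not> Im (z m) \<le> 0"
  define U where "U t = (\<Sum>n. osc_term n t)" for t
  define S where "S = (\<Sum>n. w n / norm (z n) ^ 2)"
  define t1 where "t1 = max t0 0"
  \<comment> \<open>Bounds \<open>\<bar>c * t\<^sup>2 + Re (U t)\<bar>\<close> on the initial
    interval from \<open>0\<close> to \<open>t1\<close>, where nothing is known about the
    sign.\<close>
  define C where "C = 2 * exp (b * t1) * S + \<bar>c\<bar> * t1\<^sup>2"
  define u where "u t = C + c * t\<^sup>2 + Re (U t)" for t
  have S0: "S \<ge> 0" unfolding S_def by (rule suminf_nonneg[OF summable_w]) (use w_nonneg in auto)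
  have C0: "C \<ge> 0" using S0 by (simp add: C_def)
  have Ub: "norm (U t) \<le> 2 * exp (b * t) * S" if "t \<ge> 0" for t
  proof -
    have "norm (U t) \<le> (\<Sum>n. 2 * exp (b * t) * (w n / norm (z n) ^ 2))"
      unfolding U_def using norm_osc_term_le[OF b that] by (intro norm_suminf_le summable_mult summable_w)
    also have "\<dots> = 2 * exp (b * t) * S" unfolding S_def by (rule suminf_mult[OF summable_w])
    finally show ?thesis .
  qed
  have u0: "u t \<ge> 0" if t: "t \<ge> 0" for t
  proof (cases "t \<ge> t0")
    case True thus ?thesis using nonneg C0 by (simp add: u_def U_def add.assoc)
  next
    case False
    hence "t \<le> t1" by (simp add: t1_def)
    have "\<bar>Re (U t)\<bar> \<le> 2 * exp (b * t) * S" using Ub[OF t] abs_Re_le_cmod order_trans by blast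
    also have "\<dots> \<le> 2 * exp (b * t1) * S"
      using \<open>t \<le> t1\<close> b(2) S0 by (intro mult_right_mono mult_left_mono) (auto intro: mult_left_mono)
    finally have 1: "Re (U t) \<ge> - (2 * exp (b * t1) * S)" by simp
    have "\<bar>c * t\<^sup>2\<bar> \<le> \<bar>c\<bar> * t1\<^sup>2"
      using t \<open>t \<le> t1\<close> by (simp add: abs_mult power_mono mult_left_mono)
    thus ?thesis using 1 by (simp add: u_def C_def)
  qed
  have [measurable]: "U \<in> borel_measurable borel"
    unfolding U_def [abs_def] osc_term_def by measurable
  have [measurable]: "u \<in> borel_measurable borel" unfolding u_def [abs_def] by measurable
  \<comment> \<open>The indicator confines the measure to the half-line, the only place where
    \<open>u\<close> is known to be nonnegative.\<close>
  define M where "M = density lborel (\<lambda>t. ennreal (indicator {0..} t * u t))"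
  have iu0: "AE t in lborel. 0 \<le> indicator {0..} t * u t" using u0 by (auto simp: indicator_def)
  have sets_M: "sets M = sets borel" by (simp add: M_def)
  have nonneg_M: "AE t in M. t \<ge> 0"
    unfolding M_def by (subst AE_density) (auto simp: indicator_def)
  have int: "has_bochner_integral lborel (\<lambda>t. indicator {0..} t * u t * exp (- x * t))
     (C / x + 2 * c / x ^ 3 + Re (frac_sum (of_real x) / of_real x))" if x: "x > b" for x
  proof -
    have x0: "x > 0" using x b by simp
    have "has_bochner_integral lborel (\<lambda>t. indicator {0..} t *\<^sub>R exp (- of_real x * complex_of_real t)) (1 / of_real x)"
      by (rule has_bochner_integral_exp_Ici) (use x0 in auto)
    hence "has_bochner_integral lborel (\<lambda>t. Re (indicator {0..} t *\<^sub>R exp (- of_real x * complex_of_real t))) (Re (1 / of_real x))"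
      by (rule has_bochner_integral_Re)
    hence 1: "has_bochner_integral lborel (\<lambda>t. indicator {0..} t * exp (- x * t)) (1 / x)"
      using x0 by (simp add: Re_exp Re_divide power2_eq_square)
    have 3: "has_bochner_integral lborel (\<lambda>t. Re (indicator {0..} t *\<^sub>R (U t * of_real (exp (- x * t)))))
              (Re (frac_sum (of_real x) / of_real x))"
      unfolding U_def by (intro has_bochner_integral_Re has_bochner_integral_osc_sum[OF b x])
    have "has_bochner_integral lborel (\<lambda>t. C * (indicator {0..} t * exp (- x * t)) +
              c * (indicator {0..} t * (t\<^sup>2 * exp (- x * t))) +
              Re (indicator {0..} t *\<^sub>R (U t * of_real (exp (- x * t)))))
           (C * (1 / x) + c * (2 / x ^ 3) + Re (frac_sum (of_real x) / of_real x))"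
      by (intro has_bochner_integral_add has_bochner_integral_mult_right 1 3
          has_bochner_integral_power2_exp_Ici x0)
    also have "(\<lambda>t. C * (indicator {0..} t * exp (- x * t)) +
              c * (indicator {0..} t * (t\<^sup>2 * exp (- x * t))) +
              Re (indicator {0..} t *\<^sub>R (U t * of_real (exp (- x * t)))))
           = (\<lambda>t. indicator {0..} t * u t * exp (- x * t))"
      by (auto simp: u_def fun_eq_iff algebra_simps)
    finally show ?thesis by (simp add: mult.commute)
  qed
  \<comment> \<open>On the real axis the transform involves \<open>Re (frac_sum x)\<close>. Half the
    sum of \<open>frac_sum s\<close> and \<open>cnj (frac_sum (cnj s))\<close> is its holomorphic
    continuation; the price is a second family of poles, conjugate to the first.\<close>
  define \<Phi> where "\<Phi> s = of_real C / s + 2 * of_real c / s ^ 3 + (frac_sum s + cnj (frac_sum (cnj s))) / (2 * s)" for s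
  define P where "P = poles \<union> {s. cnj s \<in> poles}"
  have cP: "closed {s. cnj s \<in> poles}"
    using continuous_closed_vimage[OF closed_poles, of cnj] by (auto simp: vimage_def isCont_cnj)
  have hc: "(\<lambda>s. cnj (frac_sum (cnj s))) holomorphic_on - {s. cnj s \<in> poles}"
  proof -
    have "cnj \<circ> frac_sum \<circ> cnj holomorphic_on - {s. cnj s \<in> poles}"
      by (rule holomorphic_on_compose_cnj_cnj, rule holomorphic_on_subset[OF frac_sum_holomorphic])
         (use cP in auto)
    thus ?thesis by (simp add: o_def)
  qed
  have L: "laplace M holomorphic_on {s. Re s > 0}"
    "\<And>s. s \<in> {s. Re s > 0} - P \<Longrightarrow> laplace M s = \<Phi> s"
  proof -
    have fin: "laplace_finite M x" if "x > b" for x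
    proof -
      have "integrable lborel (\<lambda>t. (indicator {0..} t * u t) *\<^sub>R exp (- x * t))"
        using int[OF that] by (simp add: has_bochner_integral_iff)
      thus ?thesis unfolding laplace_finite_iff[OF sets_M nonneg_M] unfolding M_def
        by (subst integrable_density) (use iu0 in auto)
    qed
    have eq: "laplace M (of_real x) = \<Phi> (of_real x)" if "x > b" for x
    proof -
      have "laplace M (of_real x) = (LINT t|lborel. (indicator {0..} t * u t) *\<^sub>R exp (- of_real x * complex_of_real t))"
        unfolding laplace_def M_def by (subst integral_density) (use iu0 in auto)
      also have "(\<lambda>t. (indicator {0..} t * u t) *\<^sub>R exp (- of_real x * complex_of_real t))
           = (\<lambda>t. complex_of_real (indicator {0..} t * u t * exp (- x * t)))"
        by (auto simp: fun_eq_iff scaleR_conv_of_real exp_of_real [symmetric])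
      also have "integral\<^sup>L lborel \<dots> = of_real (C / x + 2 * c / x ^ 3 + Re (frac_sum (of_real x) / of_real x))"
        using int[OF that] by (simp only: integral_complex_of_real) (simp add: has_bochner_integral_iff)
      also have "\<dots> = \<Phi> (of_real x)"
        using that b by (simp add: \<Phi>_def complex_add_cnj Re_divide power2_eq_square)
      finally show ?thesis .
    qed
    have P1: "countable P"
    proof -
      have "{s. cnj s \<in> poles} = cnj ` poles" by (auto simp: image_iff) (metis complex_cnj_cnj)
      thus ?thesis using countable_poles by (simp add: P_def)
    qed
    have P2: "open ({s. Re s > 0} - P)"
      using cP closed_poles by (intro open_Diff open_halfspace_Re_gt) (auto simp: P_def)
    have P3: "of_real x \<notin> P" if "x > 0" for x
    proof
      assume "complex_of_real x \<in> P"
      then obtain n where n: "w n \<noteq> 0" "of_real x = - \<i> * z n" by (auto simp: P_def poles_def)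
      have "Re (z n) = - Im (- \<i> * z n)" by simp
      also have "\<dots> = 0" unfolding n(2) [symmetric] by simp
      finally show False using imag n by simp
    qed
    have hol: "\<Phi> holomorphic_on {s. Re s > 0} - P"
      unfolding \<Phi>_def [abs_def]
      by (intro holomorphic_intros holomorphic_on_subset[OF hc] holomorphic_on_subset[OF frac_sum_holomorphic])
         (auto simp: P_def)
    show "laplace M holomorphic_on {s. Re s > 0}"
      "\<And>s. s \<in> {s. Re s > 0} - P \<Longrightarrow> laplace M s = \<Phi> s"
      using landau[OF sets_M nonneg_M P1 P2 P3 hol fin eq] by auto
  qed
  define p where "p = - \<i> * z m"
  have p: "Re p > 0" using \<open>\<not> Im (z m) \<le> 0\<close> by (simp add: p_def)
  hence p0: "p \<noteq> 0" by auto
  have cnj_lim: "filterlim cnj (at (cnj p)) (at p)"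
    by (auto simp: filterlim_at eventually_at_filter intro!: tendsto_intros)
  have "eventually (\<lambda>s. Re s > 0) (at p)"
    using eventually_at_in_open'[OF open_halfspace_Re_gt[of 0], of p] p by simp
  moreover have "eventually (\<lambda>s. s \<notin> poles) (at q)" for q
    using not_islimpt_poles[of q] by (simp add: islimpt_iff_eventually)
  hence "eventually (\<lambda>s. s \<notin> poles) (at p)" "eventually (\<lambda>s. cnj s \<notin> poles) (at p)"
    using cnj_lim by (auto simp: filterlim_iff)
  ultimately have ev: "eventually (\<lambda>s. (s - p) * laplace M s = (s - p) * \<Phi> s) (at p)"
    by eventually_elim (use L(2) in \<open>auto simp: P_def\<close>)
  have "isCont (laplace M) p"
    using L(1) p open_halfspace_Re_gt[of 0] continuous_on_eq_continuous_at holomorphic_on_imp_continuous_on by blast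
  \<comment> \<open>As the transform is holomorphic at \<open>p\<close>, the limit is
    \<open>0\<close>; computed from \<open>\<Phi>\<close> it must agree with the combined
    residue.\<close>
  hence "((\<lambda>s. (s - p) * laplace M s) \<longlongrightarrow> (p - p) * laplace M p) (at p)"
    by (intro tendsto_intros) (auto simp: isCont_def)
  hence lim0: "((\<lambda>s. (s - p) * \<Phi> s) \<longlongrightarrow> 0) (at p)"
    using ev by (auto intro: Lim_transform_eventually)
  have l1: "((\<lambda>s. (s - p) * frac_sum s) \<longlongrightarrow> of_real (pole_weight p) / p) (at p)"
    by (rule frac_sum_residue[OF p0])
  \<comment> \<open>Conjugating the residue at \<open>cnj p\<close> gives again a nonnegative
    multiple of \<open>1 / p\<close>, possibly zero, so it cannot cancel the residue of the first
    summand.\<close>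
  have "((\<lambda>s. cnj ((cnj s - cnj p) * frac_sum (cnj s))) \<longlongrightarrow> cnj (of_real (pole_weight (cnj p)) / cnj p)) (at p)"
    by (intro tendsto_cnj filterlim_compose[OF frac_sum_residue cnj_lim]) (use p0 in auto)
  hence l2: "((\<lambda>s. (s - p) * cnj (frac_sum (cnj s))) \<longlongrightarrow> of_real (pole_weight (cnj p)) / p) (at p)"
    by simp
  have "((\<lambda>s. (s - p) * (of_real C / s + 2 * of_real c / s ^ 3) +
           ((s - p) * frac_sum s + (s - p) * cnj (frac_sum (cnj s))) / (2 * s)) \<longlongrightarrow>
         (p - p) * (of_real C / p + 2 * of_real c / p ^ 3) +
           (of_real (pole_weight p) / p + of_real (pole_weight (cnj p)) / p) / (2 * p)) (at p)"
    using p0 by (intro tendsto_intros l1 l2) auto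
  also have "(\<lambda>s. (s - p) * (of_real C / s + 2 * of_real c / s ^ 3) +
           ((s - p) * frac_sum s + (s - p) * cnj (frac_sum (cnj s))) / (2 * s)) = (\<lambda>s. (s - p) * \<Phi> s)"
    by (simp add: \<Phi>_def fun_eq_iff ring_distribs add_divide_distrib)
  finally have lim1: "((\<lambda>s. (s - p) * \<Phi> s) \<longlongrightarrow> (p - p) * (of_real C / p + 2 * of_real c / p ^ 3) +
           (of_real (pole_weight p) / p + of_real (pole_weight (cnj p)) / p) / (2 * p)) (at p)" .
  have "(p - p) * (of_real C / p + 2 * of_real c / p ^ 3) +
           (of_real (pole_weight p) / p + of_real (pole_weight (cnj p)) / p) / (2 * p) = 0"
    by (rule tendsto_unique[OF _ lim1 lim0]) simp
  hence "complex_of_real (pole_weight p + pole_weight (cnj p)) = 0"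
    using p0 by (simp add: field_simps)
  hence "pole_weight p + pole_weight (cnj p) = 0" by (simp only: of_real_eq_0_iff)
  moreover have "pole_weight q \<ge> 0" for q
    unfolding pole_weight_def by (rule sum_nonneg) (use w_nonneg in auto)
  moreover have "pole_weight p \<ge> w m"
    unfolding pole_weight_def using m w_nonneg finite_poles[of p] by (intro member_le_sum) (simp_all add: p_def)
  ultimately show False using w_nonneg[of m] m by (smt (verit))
qed

end

section \<open>Zeros and growth of entire functions\<close>

lemma exp_beats_power_at_bot:
  fixes a c D :: real
  assumes "a > 0" "c > 0"
  shows "filterlim (\<lambda>Y. D * (A + Y) ^ N - c * exp (Y / a)) at_bot at_top"
  using assms by real_asymp

section \<open>Splitting off and counting zeros\<close>

text \<open>The quotient is glued from \<open>zor_poly\<close> near \<open>w\<close> and the plain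
  quotient elsewhere. The value \<open>f z0\<close> keeps \<open>f\<close> from vanishing
  identically; where \<open>f w\<close> is nonzero the exponent is \<open>0\<close>.\<close>

lemma factor_zero:
  assumes f: "f holomorphic_on UNIV" and nz: "f z0 \<noteq> 0"
  obtains g where "g holomorphic_on UNIV" "g w \<noteq> 0" "\<And>z. f z = g z * (z - w) ^ nat (zorder f w)"
proof -
  define k where "k = nat (zorder f w)"
  obtain r where r: "r > 0" "zor_poly f w w \<noteq> 0" "zor_poly f w holomorphic_on cball w r"
    "\<And>z. z \<in> cball w r \<Longrightarrow> f z = zor_poly f w z * (z - w) ^ k"
  proof -
    have "\<exists>w\<in>UNIV. f w \<noteq> 0" using nz by blast
    from zorder_exist_zero[OF f open_UNIV connected_UNIV UNIV_I this, of w]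
    show ?thesis using that unfolding k_def by (metis centre_in_cball less_imp_le)
  qed
  define g where "g z = (if z \<in> ball w r then zor_poly f w z else f z / (z - w) ^ k)" for z
  have eq: "g z = f z / (z - w) ^ k" if "z \<noteq> w" for z
    using r(4)[of z] that by (auto simp: g_def)
  have "g holomorphic_on ball w r"
    by (rule holomorphic_transform[of "zor_poly f w"]) (auto simp: g_def intro: holomorphic_on_subset[OF r(3)])
  moreover have "g holomorphic_on - {w}"
    by (rule holomorphic_transform[of "\<lambda>z. f z / (z - w) ^ k"])
       (auto simp: eq intro!: holomorphic_intros holomorphic_on_subset[OF f])
  ultimately have "g holomorphic_on ball w r \<union> - {w}" by (intro holomorphic_on_Un) auto
  moreover have "ball w r \<union> - {w} = UNIV" using r(1) by auto
  ultimately have "g holomorphic_on UNIV" by simp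
  moreover have "g w \<noteq> 0" using r by (simp add: g_def)
  moreover have "f z = g z * (z - w) ^ k" for z
    using r by (cases "z = w") (auto simp: eq g_def)
  ultimately show ?thesis using that unfolding k_def by blast
qed

lemma factor_zeros:
  assumes "finite N" "f holomorphic_on UNIV" "f z0 \<noteq> 0"
  shows "\<exists>g. g holomorphic_on UNIV \<and> (\<forall>z. f z = g z * (\<Prod>w\<in>N. (z - w) ^ nat (zorder f w)))"
  using assms
proof (induction N arbitrary: f)
  case empty
  thus ?case by auto
next
  case (insert v N)
  obtain h where h: "h holomorphic_on UNIV" "h v \<noteq> 0" "\<And>z. f z = h z * (z - v) ^ nat (zorder f v)"
    using factor_zero[OF insert.prems] by blast
  \<comment> \<open>The induction hypothesis speaks of orders of \<open>h\<close>, the claim of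
    orders of \<open>f\<close>; dividing by a power of \<open>z - v\<close> leaves them equal away
    from \<open>v\<close>.\<close>
  have ord: "zorder f w = zorder h w" if "w \<noteq> v" for w
  proof -
    have "zorder (\<lambda>z. h z * (z - v) ^ nat (zorder f v)) w = zorder h w + zorder (\<lambda>z. (z - v) ^ nat (zorder f v)) w"
    proof (rule zorder_times_analytic)
      show "h analytic_on {w}" using h(1) by (simp add: analytic_on_holomorphic) blast
      show "(\<lambda>z. (z - v) ^ nat (zorder f v)) analytic_on {w}" by (intro analytic_intros)
      show "\<forall>\<^sub>F z in at w. h z * (z - v) ^ nat (zorder f v) \<noteq> 0"
        unfolding h(3) [symmetric]
        using non_zero_neighbour_alt[OF insert.prems(1) open_UNIV connected_UNIV UNIV_I UNIV_I insert.prems(2)]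
        by (auto elim: eventually_mono)
    qed
    also have "zorder (\<lambda>z. (z - v) ^ nat (zorder f v)) w = 0"
      by (rule zorder_eq_0I) (use that in \<open>auto intro!: analytic_intros\<close>)
    finally show ?thesis unfolding h(3) [symmetric] by simp
  qed
  obtain g where g: "g holomorphic_on UNIV" "\<And>z. h z = g z * (\<Prod>w\<in>N. (z - w) ^ nat (zorder h w))"
    using insert.IH[OF h(1)] insert.prems(2) h(3)[of z0] by auto
  have "f z = g z * (\<Prod>w\<in>insert v N. (z - w) ^ nat (zorder f w))" for z
  proof -
    have "(\<Prod>w\<in>N. (z - w) ^ nat (zorder h w)) = (\<Prod>w\<in>N. (z - w) ^ nat (zorder f w))"
      by (intro prod.cong refl) (metis insert.hyps(2) ord)
    thus ?thesis using h(3)[of z] g(2)[of z] insert.hyps by simp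
  qed
  thus ?case using g(1) by blast
qed

text \<open>Let \<open>g\<close> be \<open>f\<close> divided by its zeros in \<open>N\<close>. On
  the circle of radius \<open>3 * R\<close> each divisor has modulus at least \<open>2 * R\<close>,
  at the centre at most \<open>R\<close>. The maximum principle for \<open>g\<close> therefore gains
  a factor 2 per zero.\<close>

lemma zeros_count_bound:
  assumes f: "f holomorphic_on UNIV" "f z0 \<noteq> 0" and R: "R > 0"
    and N: "finite N" "N \<subseteq> cball z0 R"
    and M: "\<And>z. norm (z - z0) = 3 * R \<Longrightarrow> norm (f z) \<le> M"
  shows "2 ^ (\<Sum>w\<in>N. nat (zorder f w)) * norm (f z0) \<le> M"
proof -
  define n where "n = (\<Sum>w\<in>N. nat (zorder f w))"
  obtain g where g: "g holomorphic_on UNIV" "\<And>z. f z = g z * (\<Prod>w\<in>N. (z - w) ^ nat (zorder f w))"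
    using factor_zeros[OF N(1) f] by blast
  have "norm (g z0) \<le> M / (2 * R) ^ n"
  proof (rule maximum_modulus_frontier[where S = "ball z0 (3 * R)" and f = g])
    show "norm (g z) \<le> M / (2 * R) ^ n" if "z \<in> frontier (ball z0 (3 * R))" for z
    proof -
      have z: "norm (z - z0) = 3 * R" using that R by (auto simp: dist_norm norm_minus_commute)
      have "(2 * R) ^ n = (\<Prod>w\<in>N. (2 * R) ^ nat (zorder f w))" by (simp add: n_def power_sum)
      also have "\<dots> \<le> (\<Prod>w\<in>N. norm (z - w) ^ nat (zorder f w))"
      proof (intro prod_mono conjI power_mono)
        fix w assume "w \<in> N"
        hence "norm (w - z0) \<le> R" using N by (auto simp: dist_norm norm_minus_commute)
        thus "2 * R \<le> norm (z - w)"
          using norm_triangle_ineq[of "z - w" "w - z0"] z by simp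
      qed (use R in auto)
      finally have "norm (g z) * (2 * R) ^ n \<le> norm (f z)"
        unfolding g(2)[of z] norm_mult prod_norm [symmetric] norm_power by (intro mult_left_mono) auto
      also have "\<dots> \<le> M" using M z by blast
      finally show ?thesis using R by (simp add: field_simps)
    qed
  qed (use R in \<open>auto intro: holomorphic_on_subset[OF g(1)] holomorphic_on_imp_continuous_on\<close>)
  moreover have "norm (f z0) \<le> norm (g z0) * R ^ n"
  proof -
    have "(\<Prod>w\<in>N. norm (z0 - w) ^ nat (zorder f w)) \<le> (\<Prod>w\<in>N. R ^ nat (zorder f w))"
      using N by (intro prod_mono conjI power_mono) (auto simp: dist_norm)
    also have "\<dots> = R ^ n" by (simp add: n_def power_sum)
    finally show ?thesis
      unfolding g(2)[of z0] norm_mult prod_norm [symmetric] norm_power by (intro mult_left_mono) auto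
  qed
  ultimately have "norm (f z0) \<le> M / (2 * R) ^ n * R ^ n"
    using R by (meson mult_right_mono order_trans zero_le_power less_imp_le)
  also have "\<dots> = M / 2 ^ n" using R by (simp add: power_mult_distrib)
  finally show ?thesis by (simp add: n_def field_simps)
qed

lemma finite_zeros_cball:
  assumes "f holomorphic_on UNIV" "f z0 \<noteq> 0"
  shows "finite {w \<in> cball a R. f w = 0}"
proof (cases "\<exists>c. \<forall>z. f z = c")
  case True
  thus ?thesis using assms(2) by auto
next
  case False
  hence "\<not> f constant_on UNIV" by (auto simp: constant_on_def)
  thus ?thesis
    by (rule holomorphic_compact_finite_zeros[OF assms(1) open_UNIV connected_UNIV compact_cball subset_UNIV])
qed

definition zero_count :: "(complex \<Rightarrow> complex) \<Rightarrow> real \<Rightarrow> nat" where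
  "zero_count f R = (\<Sum>w | w \<in> cball 0 R \<and> f w = 0. nat (zorder f w))"

text \<open>The scale \<open>\<phi>\<close> is a parameter so that one calculus serves both the
  unknown order of the continued series and the fixed exponent 3/2.\<close>

definition exp_growth :: "(real \<Rightarrow> real) \<Rightarrow> complex set \<Rightarrow> (complex \<Rightarrow> complex) \<Rightarrow> bool" where
  "exp_growth \<phi> S f \<longleftrightarrow> (\<exists>C\<ge>0. \<forall>s\<in>S. norm (f s) \<le> exp (C * \<phi> (norm s)))"

definition subquadratic :: "real \<Rightarrow> real" where
  "subquadratic x = (1 + x) * sqrt (1 + x)"

text \<open>Radii \<open>4 ^ k\<close> turn the exponent 3/2 into the integer power
  \<open>8 ^ k\<close>.\<close>

lemma zero_count_le:
  assumes f: "f holomorphic_on UNIV" "f z0 \<noteq> 0" and gr: "exp_growth subquadratic UNIV f"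
  obtains A where "A \<ge> 0" "\<And>k. real (zero_count f (4 ^ k)) \<le> A * 8 ^ k"
proof -
  obtain C where C: "C \<ge> 0" "\<And>s. norm (f s) \<le> exp (C * ((1 + norm s) * sqrt (1 + norm s)))"
    using gr by (auto simp: exp_growth_def subquadratic_def)
  \<comment> \<open>The disc of radius \<open>4 ^ k\<close> about \<open>0\<close> lies in the one
    of radius \<open>4 ^ k + norm z0\<close> about \<open>z0\<close>. On the circle about
    \<open>z0\<close> with three times that radius, \<open>1 + norm z\<close> is at most
    \<open>a * 4 ^ k\<close>.\<close>
  define a where "a = 4 * (1 + norm z0)"
  have a: "a \<ge> 1" by (simp add: a_def)
  define A where "A = (C * (a * sqrt a) + \<bar>ln (norm (f z0))\<bar>) / ln 2"
  have "real (zero_count f (4 ^ k)) \<le> A * 8 ^ k" for k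
  proof -
    define n where "n = zero_count f (4 ^ k)"
    have k1: "(4::real) ^ k \<ge> 1" by simp
    have eq: "a * 4 ^ k * sqrt (a * 4 ^ k) = a * sqrt a * 8 ^ k"
    proof -
      have "sqrt ((4::real) ^ k) = 2 ^ k" by (simp add: real_sqrt_power)
      thus ?thesis by (simp add: real_sqrt_mult power_mult_distrib [symmetric])
    qed
    have "2 ^ n * norm (f z0) \<le> exp (C * (a * sqrt a * 8 ^ k))"
      unfolding n_def zero_count_def
    proof (rule zeros_count_bound[OF f, where R = "4 ^ k + norm z0"])
      show "{w. w \<in> cball 0 (4 ^ k) \<and> f w = 0} \<subseteq> cball z0 (4 ^ k + norm z0)"
      proof safe
        fix w :: complex assume "w \<in> cball 0 (4 ^ k)"
        thus "w \<in> cball z0 (4 ^ k + norm z0)"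
          using norm_triangle_ineq4[of z0 w] by (simp add: dist_norm)
      qed
      fix z assume z: "norm (z - z0) = 3 * (4 ^ k + norm z0)"
      have "norm z \<le> norm (z - z0) + norm z0" using norm_triangle_ineq[of "z - z0" z0] by simp
      moreover have "1 + r \<le> 4 * x + 4 * m * 1" if "r \<le> d + m" "d = 3 * (x + m)" "1 \<le> x" for r d m x :: real
        using that by simp
      ultimately have "1 + norm z \<le> 4 * 4 ^ k + 4 * norm z0 * 1" using z k1 by blast
      also have "\<dots> \<le> 4 * 4 ^ k + 4 * norm z0 * 4 ^ k"
        using k1 by (intro add_mono mult_left_mono) auto
      also have "\<dots> = a * 4 ^ k" by (simp add: a_def algebra_simps)
      finally have le: "1 + norm z \<le> a * 4 ^ k" .
      have "(1 + norm z) * sqrt (1 + norm z) \<le> a * 4 ^ k * sqrt (a * 4 ^ k)"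
        using le a by (intro mult_mono) auto
      hence "C * ((1 + norm z) * sqrt (1 + norm z)) \<le> C * (a * sqrt a * 8 ^ k)"
        unfolding eq using C(1) by (intro mult_left_mono) auto
      thus "norm (f z) \<le> exp (C * (a * sqrt a * 8 ^ k))"
        using C(2)[of z] by (meson exp_le_cancel_iff order_trans)
    qed (use finite_zeros_cball[OF f, of 0 "4 ^ k"] in \<open>auto intro: add_pos_nonneg\<close>)
    hence "ln (2 ^ n * norm (f z0)) \<le> ln (exp (C * (a * sqrt a * 8 ^ k)))"
      using f(2) by (subst ln_le_cancel_iff) auto
    hence "real n * ln 2 \<le> C * (a * sqrt a) * 8 ^ k + \<bar>ln (norm (f z0))\<bar> * 1"
      using f(2) by (simp add: ln_mult ln_realpow)
    also have "\<dots> \<le> C * (a * sqrt a) * 8 ^ k + \<bar>ln (norm (f z0))\<bar> * 8 ^ k"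
      by (intro add_left_mono mult_left_mono) auto
    finally have "real n * ln 2 \<le> (C * (a * sqrt a) + \<bar>ln (norm (f z0))\<bar>) * 8 ^ k"
      by (simp add: algebra_simps)
    thus ?thesis by (simp add: n_def A_def field_simps)
  qed
  moreover have "0 \<le> a * sqrt a" using a by simp
  hence "0 \<le> C * (a * sqrt a)" using C(1) by simp
  hence "A \<ge> 0" by (simp add: A_def)
  ultimately show ?thesis using that by blast
qed

text \<open>In the shell between radii \<open>4 ^ k\<close> and \<open>4 ^ Suc k\<close> there are
  at most \<open>A * 8 ^ Suc k\<close> zeros with multiplicity, each weighted by at most
  \<open>1 / 16 ^ k\<close>. The shells contribute a geometric series of ratio 1/2.\<close>

lemma summable_zeros:
  assumes f: "f holomorphic_on UNIV" "f z0 \<noteq> 0" and gr: "exp_growth subquadratic UNIV f"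
  shows "(\<lambda>w. real (nat (zorder f w)) / norm w ^ 2) summable_on {w. f w = 0 \<and> w \<noteq> 0}"
proof -
  obtain A where A: "A \<ge> 0" "\<And>k. real (zero_count f (4 ^ k)) \<le> A * 8 ^ k"
    using zero_count_le[OF assms] by blast
  define h where "h w = real (nat (zorder f w)) / norm w ^ 2" for w
  define Z where "Z R = {w. w \<in> cball 0 R \<and> f w = 0}" for R
  have fin: "finite (Z R)" for R using finite_zeros_cball[OF f, of 0 R] by (simp add: Z_def)
  have h0: "h w \<ge> 0" for w by (simp add: h_def)
  define S where "S k = (\<Sum>w\<in>Z (4 ^ k). h w)" for k :: nat
  have step: "S (Suc k) \<le> S k + 8 * A / 2 ^ k" for k
  proof -
    have sub: "Z (4 ^ k) \<subseteq> Z (4 ^ Suc k)"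
      by (auto simp: Z_def intro: order_trans)
    have "S (Suc k) = S k + (\<Sum>w\<in>Z (4 ^ Suc k) - Z (4 ^ k). h w)"
      unfolding S_def using sum.subset_diff[OF sub fin, of h] by simp
    also have "(\<Sum>w\<in>Z (4 ^ Suc k) - Z (4 ^ k). h w)
              \<le> (\<Sum>w\<in>Z (4 ^ Suc k) - Z (4 ^ k). real (nat (zorder f w)) / 16 ^ k)"
    proof (rule sum_mono)
      fix w assume "w \<in> Z (4 ^ Suc k) - Z (4 ^ k)"
      hence "norm w \<ge> 4 ^ k" by (auto simp: Z_def)
      hence "norm w ^ 2 \<ge> (4 ^ k) ^ 2" by (intro power_mono) auto
      also have "((4::real) ^ k) ^ 2 = 16 ^ k"
        by (simp add: power2_eq_square power_mult_distrib [symmetric])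
      finally have "norm w ^ 2 \<ge> 16 ^ k" .
      moreover have "norm w ^ 2 > 0" using calculation by (rule less_le_trans[rotated]) simp
      ultimately show "h w \<le> real (nat (zorder f w)) / 16 ^ k"
        unfolding h_def by (intro divide_left_mono) auto
    qed
    also have "\<dots> \<le> (\<Sum>w\<in>Z (4 ^ Suc k). real (nat (zorder f w)) / 16 ^ k)"
      by (rule sum_mono2) (use fin in auto)
    also have "\<dots> = real (zero_count f (4 ^ Suc k)) / 16 ^ k"
      by (simp add: zero_count_def Z_def sum_divide_distrib)
    also have "\<dots> \<le> A * 8 ^ Suc k / 16 ^ k" by (intro divide_right_mono A) auto
    also have "\<dots> = 8 * A / 2 ^ k"
    proof -
      have "(16::real) ^ k = 8 ^ k * 2 ^ k" by (simp add: power_mult_distrib [symmetric])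
      thus ?thesis by simp
    qed
    finally show ?thesis by simp
  qed
  \<comment> \<open>The closed form of the partial geometric sums, needed to make the induction go
    through.\<close>
  have S: "S k \<le> S 0 + 16 * A * (1 - 1 / 2 ^ k)" for k
  proof (induction k)
    case (Suc k)
    have "S (Suc k) \<le> S 0 + 16 * A * (1 - 1 / 2 ^ k) + 8 * A / 2 ^ k" using step[of k] Suc by simp
    also have "\<dots> = S 0 + 16 * A * (1 - 1 / 2 ^ Suc k)" by (simp add: field_simps)
    finally show ?case .
  qed simp
  have "h summable_on {w. f w = 0 \<and> w \<noteq> 0}"
  proof (rule nonneg_bdd_above_summable_on)
    show "bdd_above (sum h ` {F. F \<subseteq> {w. f w = 0 \<and> w \<noteq> 0} \<and> finite F})"
    proof (rule bdd_aboveI2)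
      fix F assume F: "F \<in> {F. F \<subseteq> {w. f w = 0 \<and> w \<noteq> 0} \<and> finite F}"
      have "bounded F" using F finite_imp_bounded by blast
      then obtain B where B: "\<And>w. w \<in> F \<Longrightarrow> norm w \<le> B" by (auto simp: bounded_iff)
      obtain k where "B < 4 ^ k" using real_arch_pow[of 4 B] by auto
      hence "F \<subseteq> Z (4 ^ k)" using F B by (force simp: Z_def)
      hence "sum h F \<le> S k" unfolding S_def by (intro sum_mono2 fin) (use h0 in auto)
      also have "\<dots> \<le> S 0 + 16 * A * (1 - 1 / 2 ^ k)" by (rule S)
      also have "\<dots> \<le> S 0 + 16 * A * 1" using A(1) by (intro add_mono mult_left_mono) auto
      finally show "sum h F \<le> S 0 + 16 * A * 1" .
    qed
  qed (use h0 in auto)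
  thus ?thesis by (simp add: h_def [abs_def])
qed

text \<open>The damping factor \<open>exp (- \<epsilon> * cos (s / a))\<close> has modulus at most 1
  in the strip and decays doubly exponentially in \<open>\<bar>Im s\<bar>\<close>, which beats the
  exponential of any power. The maximum principle on a tall rectangle bounds the damped function by
  \<open>K\<close>; then \<open>\<epsilon>\<close> tends to \<open>0\<close>.\<close>

lemma phragmen_lindelof_strip:
  fixes f :: "complex \<Rightarrow> complex"
  assumes a: "a > 0" and T: "open T" "{s. \<bar>Re s\<bar> \<le> a} \<subseteq> T" and f: "f holomorphic_on T"
    and K: "K > 0" "\<And>s. \<bar>Re s\<bar> = a \<Longrightarrow> norm (f s) \<le> K"
    and D: "D \<ge> 0" "\<And>s. \<bar>Re s\<bar> \<le> a \<Longrightarrow> norm (f s) \<le> exp (D * (1 + norm s) ^ N)"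
    and s: "\<bar>Re s\<bar> \<le> a"
  shows "norm (f s) \<le> K"
proof (cases "\<bar>Re s\<bar> = a")
  case True
  thus ?thesis by (rule K)
next
  case False
  hence sa: "\<bar>Re s\<bar> < a" using s by simp
  \<comment> \<open>After scaling by \<open>a\<close> the real part stays in \<open>[-1, 1]\<close>,
    where the cosine is at least \<open>cos 1\<close>; the 2 comes from replacing the hyperbolic
    cosine by half its larger exponential.\<close>
  define \<delta> where "\<delta> = cos (1::real) / 2"
  have \<delta>: "\<delta> > 0" unfolding \<delta>_def using pi_gt3 by (intro divide_pos_pos cos_gt_zero) auto
  have recos: "Re (cos (v / of_real a)) \<ge> \<delta> * exp (\<bar>Im v\<bar> / a)" if v: "\<bar>Re v\<bar> \<le> a" for v
  proof -
    have "cos 1 \<le> cos \<bar>Re v / a\<bar>"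
      by (rule cos_monotone_0_pi_le) (use v a pi_gt3 in \<open>auto simp: abs_divide\<close>)
    moreover have "cos \<bar>Re v / a\<bar> = cos (Re v / a)" by (auto simp only: abs_if cos_minus split: if_splits)
    ultimately have 1: "cos 1 \<le> cos (Re v / a)" by simp
    have 2: "exp (\<bar>Im v\<bar> / a) \<le> exp (Im v / a) + exp (- (Im v / a))"
      by (cases "Im v \<ge> 0") (auto intro: add_increasing add_increasing2)
    have "cos 1 * exp (\<bar>Im v\<bar> / a) \<le> cos (Re v / a) * (exp (Im v / a) + exp (- (Im v / a)))"
      by (rule mult_mono[OF 1 2]) (use 1 \<delta> in \<open>auto simp: \<delta>_def\<close>)
    thus ?thesis by (simp add: Re_cos \<delta>_def)
  qed
  have main: "norm (f s) * exp (- \<epsilon> * Re (cos (s / of_real a))) \<le> K" if \<epsilon>: "\<epsilon> > 0" for \<epsilon>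
  proof -
    define g where "g v = f v * exp (- of_real \<epsilon> * cos (v / of_real a))" for v
    have ng: "norm (g v) = norm (f v) * exp (- \<epsilon> * Re (cos (v / of_real a)))" for v
      by (simp add: g_def norm_mult)
    have "\<forall>\<^sub>F Y in at_top. D * (1 + a + Y) ^ N - \<epsilon> * \<delta> * exp (Y / a) \<le> ln K"
      using exp_beats_power_at_bot[of a "\<epsilon> * \<delta>" D "1 + a" N] a \<epsilon> \<delta> by (simp add: filterlim_at_bot)
    moreover have "\<forall>\<^sub>F Y in at_top. Y > \<bar>Im s\<bar>" by (rule eventually_gt_at_top)
    ultimately have "\<forall>\<^sub>F Y in at_top. D * (1 + a + Y) ^ N - \<epsilon> * \<delta> * exp (Y / a) \<le> ln K \<and> Y > \<bar>Im s\<bar>"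
      by (rule eventually_conj)
    then obtain Y where Y: "D * (1 + a + Y) ^ N - \<epsilon> * \<delta> * exp (Y / a) \<le> ln K" "Y > \<bar>Im s\<bar>"
      using eventually_happens' trivial_limit_at_top_linorder by (metis (no_types, lifting))
    have Y0: "Y > 0" using Y(2) by simp
    let ?B = "box (Complex (- a) (- Y)) (Complex a Y)"
    have mem: "v \<in> ?B \<longleftrightarrow> \<bar>Re v\<bar> < a \<and> \<bar>Im v\<bar> < Y"
      "v \<in> cbox (Complex (- a) (- Y)) (Complex a Y) \<longleftrightarrow> \<bar>Re v\<bar> \<le> a \<and> \<bar>Im v\<bar> \<le> Y" for v
      by (auto simp: in_box_complex_iff in_cbox_complex_iff)
    have ne: "?B \<noteq> {}" using mem(1)[of s] sa Y(2) by blast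
    have subT: "cbox (Complex (- a) (- Y)) (Complex a Y) \<subseteq> T" using T(2) mem(2) by blast
    have gT: "g holomorphic_on T" unfolding g_def [abs_def] using a by (intro holomorphic_intros f) auto
    have "norm (g s) \<le> K"
    proof (rule maximum_modulus_frontier[where S = ?B and f = g])
      show "g holomorphic_on interior ?B"
        using subT box_subset_cbox interior_subset by (intro holomorphic_on_subset[OF gT]) blast
      show "continuous_on (closure ?B) g"
        using subT closure_box[OF ne] by (intro holomorphic_on_imp_continuous_on holomorphic_on_subset[OF gT]) auto
      show "s \<in> ?B" using sa Y(2) mem by blast
      fix v assume "v \<in> frontier ?B"
      hence v: "\<bar>Re v\<bar> \<le> a" "\<bar>Im v\<bar> \<le> Y" "\<bar>Re v\<bar> = a \<or> \<bar>Im v\<bar> = Y"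
        using ne mem by (auto simp: frontier_box)
      have "Re (cos (v / of_real a)) \<ge> 0" using recos[OF v(1)] \<delta> by (smt (verit) exp_gt_zero mult_pos_pos)
      show "norm (g v) \<le> K"
      proof (cases "\<bar>Re v\<bar> = a")
        case True
        have "norm (f v) * exp (- \<epsilon> * Re (cos (v / of_real a))) \<le> K * 1"
          using K \<epsilon> True \<open>Re (cos (v / of_real a)) \<ge> 0\<close> by (intro mult_mono) auto
        thus ?thesis by (simp add: ng)
      next
        case False
        hence imv: "\<bar>Im v\<bar> = Y" using v by blast
        have nv: "1 + norm v \<le> 1 + a + Y" using cmod_le[of v] v imv by simp
        have "norm (f v) \<le> exp (D * (1 + norm v) ^ N)" by (rule D(2)[OF v(1)])
        also have "\<dots> \<le> exp (D * (1 + a + Y) ^ N)"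
          using D(1) nv by (simp add: mult_left_mono power_mono)
        finally have "norm (g v) \<le> exp (D * (1 + a + Y) ^ N) * exp (- \<epsilon> * (\<delta> * exp (Y / a)))"
          unfolding ng using recos[OF v(1)] \<epsilon> imv by (intro mult_mono) auto
        also have "\<dots> = exp (D * (1 + a + Y) ^ N - \<epsilon> * \<delta> * exp (Y / a))"
          by (simp add: exp_add [symmetric])
        also have "\<dots> \<le> exp (ln K)" using Y(1) by simp
        finally show ?thesis using K(1) by simp
      qed
    qed auto
    thus ?thesis by (simp add: ng)
  qed
  have "((\<lambda>\<epsilon>. norm (f s) * exp (- \<epsilon> * Re (cos (s / of_real a)))) \<longlongrightarrow> norm (f s) * exp (- 0 * Re (cos (s / of_real a)))) (at_right 0)"
    by (intro tendsto_intros)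
  hence lim: "((\<lambda>\<epsilon>. norm (f s) * exp (- \<epsilon> * Re (cos (s / of_real a)))) \<longlongrightarrow> norm (f s)) (at_right 0)" by simp
  show ?thesis
    by (rule tendsto_upperbound[OF lim eventually_at_rightI[of 0 1]])
       (simp_all only: greaterThanLessThan_iff main trivial_limit_at_right_real not_False_eq_True zero_less_one)
qed

section \<open>Crude bounds for Gamma\<close>

text \<open>Already true for the approximants in Euler's limit formula: the numerator has the same
  modulus at \<open>z\<close> and \<open>Re z\<close>, and each denominator factor satisfies
  \<open>\<bar>z + i\<bar> \<ge> Re z + i\<close>.\<close>

lemma norm_Gamma_le:
  assumes "Re z > 0" shows "norm (Gamma z) \<le> Gamma (Re z)"
proof (rule tendsto_le[OF _ Gamma_series_LIMSEQ tendsto_norm[OF Gamma_series_LIMSEQ]])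
  show "\<forall>\<^sub>F n in sequentially. norm (Gamma_series z n) \<le> Gamma_series (Re z) n"
    using eventually_gt_at_top[of 0]
  proof eventually_elim
    case (elim n)
    have "pochhammer (Re z) (n + 1) \<le> norm (pochhammer z (n + 1))"
      unfolding pochhammer_prod prod_norm [symmetric]
    proof (intro prod_mono conjI)
      fix i
      show "Re z + of_nat i \<le> norm (z + of_nat i)"
        using complex_Re_le_cmod[of "z + of_nat i"] by simp
    qed (use assms in auto)
    moreover have "pochhammer (Re z) (n + 1) > 0" using assms by (rule pochhammer_pos)
    ultimately show ?case
      unfolding Gamma_series_def norm_divide norm_mult using elim
      by (intro frac_le mult_mono) auto
  qed
qed auto

text \<open>From 3/2 on Gamma is increasing, so it is at most \<open>fact n \<le> n ^ n\<close> for
  \<open>n\<close> the ceiling of \<open>x\<close>. The logarithm is absorbed by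
  \<open>ln (1 + x) = 2 * ln (sqrt (1 + x)) \<le> 2 * sqrt (1 + x)\<close>.\<close>

lemma Gamma_real_le:
  fixes x :: real assumes "x \<ge> 3 / 2" shows "Gamma x \<le> exp (2 * ((1 + x) * sqrt (1 + x)))"
proof -
  define n where "n = nat \<lceil>x\<rceil>"
  have n: "real n \<ge> x" "real n \<le> x + 1" unfolding n_def using assms by linarith+
  have n0: "n > 0" using n(1) assms by (intro gr0I) auto
  have "Gamma x \<le> Gamma (1 + real n)"
    using Gamma_real_strict_mono[of x "1 + real n"] assms n by simp
  also have "\<dots> = fact n" by (rule Gamma_fact)
  also have "\<dots> \<le> real n ^ n" using fact_le_power[where 'a = real, of n] by simp
  also have "\<dots> = exp (real n * ln (real n))" using n0 by (simp add: exp_of_nat_mult)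
  also have "real n * ln (real n) \<le> (1 + x) * (2 * sqrt (1 + x))"
  proof (intro mult_mono)
    have "ln (real n) \<le> ln (1 + x)" using n n0 assms by simp
    also have "\<dots> = 2 * ln (sqrt (1 + x))" using assms by (simp add: ln_sqrt)
    also have "ln (sqrt (1 + x)) \<le> sqrt (1 + x)" using assms ln_bound[of "sqrt (1 + x)"] by simp
    finally show "ln (real n) \<le> 2 * sqrt (1 + x)" by simp
  qed (use n n0 assms in auto)
  finally show ?thesis by (simp add: mult_ac)
qed

section \<open>A calculus of growth bounds\<close>

text \<open>The linear lower bound absorbs constants, polynomials and exponentials. The last
  condition makes affine substitutions cost only a constant; they occur as the arguments of the
  Gamma factors and as the reflection \<open>1 - cnj s\<close>.\<close>

definition growth_scale :: "(real \<Rightarrow> real) \<Rightarrow> bool" where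
  "growth_scale \<phi> \<longleftrightarrow> (\<forall>x\<ge>0. 1 + x \<le> \<phi> x) \<and> (\<forall>x y. 0 \<le> x \<longrightarrow> x \<le> y \<longrightarrow> \<phi> x \<le> \<phi> y) \<and>
     (\<forall>c\<ge>1. \<exists>C\<ge>0. \<forall>x\<ge>0. \<phi> (c * (1 + x)) \<le> C * \<phi> x)"

lemma growth_scaleD:
  assumes "growth_scale \<phi>" "0 \<le> x"
  shows "1 + x \<le> \<phi> x" "x \<le> y \<Longrightarrow> \<phi> x \<le> \<phi> y" "\<phi> x \<ge> 0"
  using assms by (auto simp: growth_scale_def)

lemma growth_scale_subquadratic: "growth_scale subquadratic"
  unfolding growth_scale_def
proof (intro conjI allI impI)
  fix x :: real assume x: "x \<ge> 0"
  have "(1 + x) * 1 \<le> (1 + x) * sqrt (1 + x)" using x by (intro mult_left_mono) auto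
  thus "1 + x \<le> subquadratic x" by (simp add: subquadratic_def)
next
  fix x y :: real assume "0 \<le> x" "x \<le> y"
  thus "subquadratic x \<le> subquadratic y" unfolding subquadratic_def by (intro mult_mono) auto
next
  fix c :: real assume c: "c \<ge> 1"
  show "\<exists>C\<ge>0. \<forall>x\<ge>0. subquadratic (c * (1 + x)) \<le> C * subquadratic x"
  proof (intro exI conjI allI impI)
    fix x :: real assume x: "x \<ge> 0"
    have "1 * 1 \<le> c * (1 + x)" using c x by (intro mult_mono) auto
    hence le: "1 + c * (1 + x) \<le> 2 * c * (1 + x)" by simp
    have "subquadratic (c * (1 + x)) \<le> (2 * c * (1 + x)) * sqrt (2 * c * (1 + x))"
      unfolding subquadratic_def using le c x by (intro mult_mono) auto
    also have "\<dots> = 2 * c * sqrt (2 * c) * subquadratic x"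
      by (simp add: subquadratic_def real_sqrt_mult)
    finally show "subquadratic (c * (1 + x)) \<le> 2 * c * sqrt (2 * c) * subquadratic x" .
  qed (use c in auto)
qed

lemma growth_scale_power:
  assumes "N \<ge> 1" shows "growth_scale (\<lambda>x. (1 + x) ^ N)"
  unfolding growth_scale_def
proof (intro conjI allI impI)
  fix x :: real assume x: "x \<ge> 0"
  thus "1 + x \<le> (1 + x) ^ N" using assms by (intro self_le_power) auto
next
  fix x y :: real assume "0 \<le> x" "x \<le> y"
  thus "(1 + x) ^ N \<le> (1 + y) ^ N" by (intro power_mono) auto
next
  fix c :: real assume c: "c \<ge> 1"
  show "\<exists>C\<ge>0. \<forall>x\<ge>0. (1 + c * (1 + x)) ^ N \<le> C * (1 + x) ^ N"
  proof (intro exI conjI allI impI)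
    fix x :: real assume x: "x \<ge> 0"
    have "1 * 1 \<le> c * (1 + x)" using c x by (intro mult_mono) auto
    hence le: "1 + c * (1 + x) \<le> 2 * c * (1 + x)" by simp
    have "(1 + c * (1 + x)) ^ N \<le> (2 * c * (1 + x)) ^ N"
      using le c x by (intro power_mono) auto
    thus "(1 + c * (1 + x)) ^ N \<le> (2 * c) ^ N * (1 + x) ^ N" by (simp add: power_mult_distrib)
  qed (use c in auto)
qed

lemma exp_growth_mult:
  assumes "exp_growth \<phi> S f" "exp_growth \<phi> S g" shows "exp_growth \<phi> S (\<lambda>s. f s * g s)"
proof -
  obtain C D where C: "C \<ge> 0" "\<And>s. s \<in> S \<Longrightarrow> norm (f s) \<le> exp (C * \<phi> (norm s))"
    and D: "D \<ge> 0" "\<And>s. s \<in> S \<Longrightarrow> norm (g s) \<le> exp (D * \<phi> (norm s))"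
    using assms by (auto simp: exp_growth_def)
  have "norm (f s * g s) \<le> exp ((C + D) * \<phi> (norm s))" if "s \<in> S" for s
    unfolding norm_mult distrib_right exp_add using C(2) D(2) that by (intro mult_mono) auto
  thus ?thesis using C(1) D(1) unfolding exp_growth_def by (meson add_nonneg_nonneg)
qed

lemma exp_growth_le:
  assumes "exp_growth \<phi> S f" "\<And>s. s \<in> T \<Longrightarrow> s \<in> S \<and> norm (g s) \<le> norm (f s)"
  shows "exp_growth \<phi> T g"
  using assms unfolding exp_growth_def by (meson order_trans)

lemma exp_growth_exp_linear:
  assumes \<phi>: "growth_scale \<phi>" and "\<And>s. s \<in> S \<Longrightarrow> norm (f s) \<le> exp (A * (1 + norm s))"
  shows "exp_growth \<phi> S f"
proof -
  have "norm (f s) \<le> exp (\<bar>A\<bar> * \<phi> (norm s))" if "s \<in> S" for s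
  proof -
    have "A * (1 + norm s) \<le> \<bar>A\<bar> * (1 + norm s)" by (intro mult_right_mono) auto
    also have "\<dots> \<le> \<bar>A\<bar> * \<phi> (norm s)" using growth_scaleD[OF \<phi>] by (intro mult_left_mono) auto
    finally show ?thesis using assms(2)[OF that] by (meson exp_le_cancel_iff order_trans)
  qed
  thus ?thesis unfolding exp_growth_def by (intro exI[of _ "\<bar>A\<bar>"]) auto
qed

lemma exp_growth_bounded:
  assumes \<phi>: "growth_scale \<phi>" and "\<And>s. s \<in> S \<Longrightarrow> norm (f s) \<le> K"
  shows "exp_growth \<phi> S f"
proof (rule exp_growth_exp_linear[OF \<phi>])
  fix s assume "s \<in> S"
  hence "norm (f s) \<le> \<bar>K\<bar>" using assms(2) by force
  also have "\<dots> \<le> exp \<bar>K\<bar>" using exp_ge_add_one_self[of "\<bar>K\<bar>"] by linarith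
  also have "\<dots> \<le> exp (\<bar>K\<bar> * (1 + norm s))" by (simp add: algebra_simps)
  finally show "norm (f s) \<le> exp (\<bar>K\<bar> * (1 + norm s))" .
qed

lemma exp_growth_const: "growth_scale \<phi> \<Longrightarrow> exp_growth \<phi> S (\<lambda>_. c)"
  by (rule exp_growth_bounded) auto

lemma exp_growth_linear:
  assumes \<phi>: "growth_scale \<phi>" shows "exp_growth \<phi> S (\<lambda>s. s + c)"
proof (rule exp_growth_exp_linear[OF \<phi>])
  fix s
  have "norm (s + c) \<le> norm s + norm c" by (rule norm_triangle_ineq)
  also have "\<dots> \<le> exp (norm s + norm c)" using exp_ge_add_one_self[of "norm s + norm c"] by linarith
  also have "\<dots> \<le> exp ((1 + norm c) * (1 + norm s))" by (simp add: algebra_simps)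
  finally show "norm (s + c) \<le> exp ((1 + norm c) * (1 + norm s))" .
qed

lemma exp_growth_power:
  assumes "growth_scale \<phi>" "exp_growth \<phi> S f" shows "exp_growth \<phi> S (\<lambda>s. f s ^ n)"
  by (induction n) (use assms in \<open>auto intro: exp_growth_mult exp_growth_const\<close>)

lemma exp_growth_prod:
  assumes "growth_scale \<phi>" "\<And>j. j \<in> J \<Longrightarrow> exp_growth \<phi> S (f j)"
  shows "exp_growth \<phi> S (\<lambda>s. \<Prod>j\<in>J. f j s)"
  using assms(2)
  by (induction J rule: infinite_finite_induct)
     (use assms(1) in \<open>auto intro: exp_growth_mult exp_growth_const\<close>)

lemma exp_growth_Un:
  assumes \<phi>: "growth_scale \<phi>" and "exp_growth \<phi> S f" "exp_growth \<phi> T f" shows "exp_growth \<phi> (S \<union> T) f"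
proof -
  obtain C D where C: "C \<ge> 0" "\<And>s. s \<in> S \<Longrightarrow> norm (f s) \<le> exp (C * \<phi> (norm s))"
    and D: "D \<ge> 0" "\<And>s. s \<in> T \<Longrightarrow> norm (f s) \<le> exp (D * \<phi> (norm s))"
    using assms by (auto simp: exp_growth_def)
  have "C * \<phi> (norm s) \<le> (C + D) * \<phi> (norm s)" "D * \<phi> (norm s) \<le> (C + D) * \<phi> (norm s)" for s :: complex
    using C(1) D(1) growth_scaleD(3)[OF \<phi>, of "norm s"] by (auto intro: mult_right_mono)
  hence "norm (f s) \<le> exp ((C + D) * \<phi> (norm s))" if "s \<in> S \<union> T" for s
    using that C(2) D(2) by (meson Un_iff exp_le_cancel_iff order_trans)
  thus ?thesis using C(1) D(1) unfolding exp_growth_def by (meson add_nonneg_nonneg)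
qed

lemma exp_growth_compose:
  assumes \<phi>: "growth_scale \<phi>" and f: "exp_growth \<phi> S f" and c: "c \<ge> 1"
    and \<tau>: "\<And>s. s \<in> T \<Longrightarrow> \<tau> s \<in> S \<and> norm (\<tau> s) \<le> c * (1 + norm s)"
  shows "exp_growth \<phi> T (\<lambda>s. f (\<tau> s))"
proof -
  obtain C where C: "C \<ge> 0" "\<And>s. s \<in> S \<Longrightarrow> norm (f s) \<le> exp (C * \<phi> (norm s))"
    using f by (auto simp: exp_growth_def)
  obtain D where D: "D \<ge> 0" "\<And>x. x \<ge> 0 \<Longrightarrow> \<phi> (c * (1 + x)) \<le> D * \<phi> x"
    using \<phi> c by (auto simp: growth_scale_def)
  have "norm (f (\<tau> s)) \<le> exp ((C * D) * \<phi> (norm s))" if s: "s \<in> T" for s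
  proof -
    have "\<phi> (norm (\<tau> s)) \<le> \<phi> (c * (1 + norm s))" using \<tau>[OF s] by (intro growth_scaleD(2)[OF \<phi>]) auto
    also have "\<dots> \<le> D * \<phi> (norm s)" by (rule D) simp
    finally have "C * \<phi> (norm (\<tau> s)) \<le> C * (D * \<phi> (norm s))" using C(1) by (rule mult_left_mono)
    thus ?thesis using C(2)[of "\<tau> s"] \<tau>[OF s] by (simp add: mult.assoc) (meson exp_le_cancel_iff order_trans)
  qed
  thus ?thesis using C(1) D(1) unfolding exp_growth_def by (meson mult_nonneg_nonneg)
qed

section \<open>The completed function\<close>

lemma Re_pos_notin_nonpos_Ints: "Re z > 0 \<Longrightarrow> z \<notin> \<int>\<^sub>\<le>\<^sub>0"
  by (auto elim!: nonpos_Ints_cases)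

lemma norm_dirichlet_term:
  "norm (a n * of_nat (Suc k) powr (- s)) = norm (a n) * real (Suc k) powr (- Re s)"
  by (simp only: norm_mult norm_powr_real_powr[of "of_nat (Suc k)"] Reals_of_nat) 
     (simp add: norm_powr_real_powr del: of_nat_Suc)

lemma norm_dirichlet_series_le:
  assumes summ: "\<And>s. Re s > 1 \<Longrightarrow> summable (\<lambda>n. norm (a (Suc n) * of_nat (Suc n) powr (- s)))"
  shows "\<exists>K. \<forall>s. Re s \<ge> 2 \<longrightarrow> norm (dirichlet_series a s) \<le> K"
proof -
  have s2: "summable (\<lambda>n. norm (a (Suc n)) * real (Suc n) powr (- 2))"
    using summ[of 2] by (simp only: norm_dirichlet_term) simp
  have "norm (dirichlet_series a s) \<le> (\<Sum>n. norm (a (Suc n)) * real (Suc n) powr (- 2))" if "Re s \<ge> 2" for s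
    unfolding dirichlet_series_def
  proof (rule norm_suminf_le[OF _ s2])
    fix n
    show "norm (a (Suc n) * of_nat (Suc n) powr (- s)) \<le> norm (a (Suc n)) * real (Suc n) powr (- 2)"
      unfolding norm_dirichlet_term using that by (intro mult_left_mono powr_mono) auto
  qed
  thus ?thesis by blast
qed

text \<open>Far to the right the first nonzero term dominates: relative to it, the tail is of size
  \<open>(p / q) powr \<sigma>\<close>, where \<open>p\<close> is its index and \<open>q\<close> the
  next one.\<close>

lemma dirichlet_series_nonzero:
  assumes summ: "\<And>s. Re s > 1 \<Longrightarrow> summable (\<lambda>n. norm (a (Suc n) * of_nat (Suc n) powr (- s)))"
    and nz: "dirichlet_series a s0 \<noteq> 0"
  shows "\<forall>\<^sub>F b in at_top. \<forall>s. Re s \<ge> b \<longrightarrow> dirichlet_series a s \<noteq> 0"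
proof -
  have s2: "summable (\<lambda>n. norm (a (Suc n)) * real (Suc n) powr (- 2))"
    using summ[of 2] by (simp only: norm_dirichlet_term) simp
  define K where "K = (\<Sum>n. norm (a (Suc n)) * real (Suc n) powr (- 2))"
  have "\<exists>n. a (Suc n) \<noteq> 0"
  proof (rule ccontr)
    assume "\<not> ?thesis"
    thus False using nz by (simp add: dirichlet_series_def)
  qed
  define k where "k = (LEAST n. a (Suc n) \<noteq> 0)"
  have k: "a (Suc k) \<noteq> 0" "\<And>n. n < k \<Longrightarrow> a (Suc n) = 0"
    unfolding k_def using \<open>\<exists>n. a (Suc n) \<noteq> 0\<close> LeastI_ex not_less_Least by (metis (mono_tags, lifting))+
  define p q where "p = real (Suc k)" and "q = real (Suc (Suc k))"
  define d where "d = ln q - ln p"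
  have pq: "0 < p" "p < q" by (auto simp: p_def q_def)
  hence d: "d > 0" by (simp add: d_def)
  have A: "norm (a (Suc k)) > 0" using k by simp
  have "\<forall>\<^sub>F b in at_top. (K * q\<^sup>2) * exp (- d * b) < norm (a (Suc k)) \<and> b \<ge> 2"
    using d A by (intro eventually_conj eventually_ge_at_top) real_asymp
  thus ?thesis
  proof eventually_elim
    case (elim b)
    show ?case
    proof (intro allI impI notI)
      fix s assume s: "b \<le> Re s" and zero: "dirichlet_series a s = 0"
      define f where "f n = a (Suc n) * of_nat (Suc n) powr (- s)" for n
      define \<sigma> where "\<sigma> = Re s"
      have \<sigma>: "\<sigma> \<ge> 2" using s elim by (simp add: \<sigma>_def)
      have K0: "K \<ge> 0" unfolding K_def by (rule suminf_nonneg[OF s2]) auto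
      have "Re s > 1" using \<sigma> by (simp add: \<sigma>_def)
      hence "summable f" unfolding f_def by (rule summable_norm_cancel[OF summ])
      hence "suminf f = (\<Sum>n. f (n + Suc k)) + sum f {..<Suc k}"
        by (rule suminf_split_initial_segment)
      also have "sum f {..<Suc k} = f k" using k by (simp add: f_def)
      finally have "suminf f = (\<Sum>n. f (n + Suc k)) + f k" .
      moreover have "suminf f = 0" using zero unfolding dirichlet_series_def f_def .
      ultimately have "norm (f k) = norm (\<Sum>n. f (n + Suc k))"
        by (metis add_eq_0_iff norm_minus_cancel)
      also have "\<dots> \<le> (\<Sum>n. norm (a (Suc (n + Suc k))) * real (Suc (n + Suc k)) powr (- 2) * q powr (2 - \<sigma>))"
      proof (rule norm_suminf_le)
        fix n
        let ?x = "real (Suc (n + Suc k))"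
        \<comment> \<open>One part, at the fixed abscissa 2, sums to a constant independent of
          \<open>s\<close>; the other is largest at the first index \<open>q\<close> of the tail and
          carries all the decay in \<open>\<sigma>\<close>.\<close>
        have "?x powr (- \<sigma>) = ?x powr (- 2) * ?x powr (2 - \<sigma>)" by (simp add: powr_add [symmetric])
        also have "?x powr (2 - \<sigma>) \<le> q powr (2 - \<sigma>)" using \<sigma> by (intro powr_mono2') (auto simp: q_def)
        finally have "?x powr (- \<sigma>) \<le> ?x powr (- 2) * q powr (2 - \<sigma>)" by (simp add: mult_left_mono)
        thus "norm (f (n + Suc k)) \<le> norm (a (Suc (n + Suc k))) * ?x powr (- 2) * q powr (2 - \<sigma>)"
          unfolding f_def norm_dirichlet_term \<sigma>_def [symmetric] mult.assoc by (intro mult_left_mono) auto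
        show "summable (\<lambda>n. norm (a (Suc (n + Suc k))) * real (Suc (n + Suc k)) powr (- 2) * q powr (2 - \<sigma>))"
          using summable_ignore_initial_segment[OF s2, of "Suc k"] by (rule summable_mult2)
      qed
      also have "\<dots> = (\<Sum>n. norm (a (Suc (n + Suc k))) * real (Suc (n + Suc k)) powr (- 2)) * q powr (2 - \<sigma>)"
        using suminf_mult2[OF summable_ignore_initial_segment[OF s2, of "Suc k"]] by metis
      also have "\<dots> \<le> K * q powr (2 - \<sigma>)"
      proof (rule mult_right_mono)
        show "(\<Sum>n. norm (a (Suc (n + Suc k))) * real (Suc (n + Suc k)) powr (- 2)) \<le> K"
        proof -
          have "0 \<le> (\<Sum>n<Suc k. norm (a (Suc n)) * real (Suc n) powr (- 2))" by (intro sum_nonneg) auto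
          thus ?thesis unfolding K_def using suminf_split_initial_segment[OF s2, of "Suc k"] by linarith
        qed
      qed auto
      also have "norm (f k) = norm (a (Suc k)) * p powr (- \<sigma>)"
        unfolding f_def norm_dirichlet_term \<sigma>_def p_def ..
      also have "q powr (2 - \<sigma>) = q\<^sup>2 * exp (- d * \<sigma>) * p powr (- \<sigma>)"
      proof -
        have "q powr (2 - \<sigma>) = q powr 2 * q powr (- \<sigma>)" by (simp add: powr_add [symmetric])
        also have "q powr 2 = q\<^sup>2" using pq by simp
        also have "q powr (- \<sigma>) = exp (- d * \<sigma>) * p powr (- \<sigma>)"
          using pq by (simp add: powr_def d_def exp_add [symmetric] algebra_simps)
        finally show ?thesis by simp
      qed
      finally have "norm (a (Suc k)) * p powr (- \<sigma>) \<le> K * q\<^sup>2 * exp (- d * \<sigma>) * p powr (- \<sigma>)"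
        by (simp add: mult_ac)
      hence "norm (a (Suc k)) \<le> K * q\<^sup>2 * exp (- d * \<sigma>)" using pq by simp
      also have "\<dots> \<le> K * q\<^sup>2 * exp (- d * b)"
        using K0 s d by (intro mult_left_mono) (auto simp: \<sigma>_def)
      finally show False using elim by simp
    qed
  qed
qed

lemma regularizes_unique:
  assumes "regularizes a m H" "regularizes a m H'" shows "H = H'"
proof
  fix z
  show "H z = H' z"
  proof (rule analytic_continuation_open[of "{s. Re s > 1}" UNIV H H'])
    show "{s. 1 < Re s} \<noteq> {}" by (auto intro!: exI[of _ 2])
  qed (use assms in \<open>auto simp: regularizes_def entire_finite_order_def open_halfspace_Re_gt\<close>)
qed

lemma continuation_eq:
  assumes "regularizes a (pole_order a) H"
  shows "continuation a s = H s / (s - 1) ^ pole_order a"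
proof -
  have "(THE H. regularizes a (pole_order a) H) = H"
    using assms regularizes_unique by blast
  thus ?thesis by (simp add: continuation_def)
qed

lemma entire_finite_order_growth:
  assumes "entire_finite_order H"
  shows "\<exists>N\<ge>1. exp_growth (\<lambda>x. (1 + x) ^ N) UNIV H"
proof -
  obtain \<rho> R0 where R0: "\<And>s. norm s \<ge> R0 \<Longrightarrow> norm (H s) \<le> exp (norm s powr \<rho>)"
    using assms by (auto simp: entire_finite_order_def eventually_at_infinity)
  define R where "R = max R0 1"
  have R: "R \<ge> 1" "\<And>s. norm s \<ge> R \<Longrightarrow> norm (H s) \<le> exp (norm s powr \<rho>)"
    using R0 by (auto simp: R_def)
  have hol: "H holomorphic_on UNIV" using assms by (simp add: entire_finite_order_def)
  define N where "N = nat \<lceil>max \<rho> 1\<rceil>"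
  have N: "real N \<ge> \<rho>" "N \<ge> 1" unfolding N_def by linarith+
  have gs: "growth_scale (\<lambda>x. (1 + x) ^ N)" by (rule growth_scale_power[OF N(2)])
  have "compact (H ` cball 0 R)"
    by (intro compact_continuous_image holomorphic_on_imp_continuous_on holomorphic_on_subset[OF hol]) auto
  then obtain B where "\<forall>y\<in>H ` cball 0 R. norm y \<le> B"
    using compact_imp_bounded bounded_iff by blast
  hence B: "norm (H s) \<le> B" if "s \<in> cball 0 R" for s using that by blast
  have "exp_growth (\<lambda>x. (1 + x) ^ N) (cball 0 R) H"
    by (rule exp_growth_bounded[OF gs B])
  moreover have "exp_growth (\<lambda>x. (1 + x) ^ N) {s. norm s \<ge> R} H"
    unfolding exp_growth_def
  proof (intro exI[of _ 1] conjI ballI)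
    fix s :: complex assume "s \<in> {s. norm s \<ge> R}"
    hence s: "norm s \<ge> R" by simp
    hence "norm (H s) \<le> exp (norm s powr \<rho>)" by (rule R)
    also have "norm s powr \<rho> \<le> norm s powr real N" using N s R(1) by (intro powr_mono) auto
    also have "\<dots> = norm s ^ N" using s R(1) by (intro powr_realpow) auto
    also have "\<dots> \<le> (1 + norm s) ^ N" by (intro power_mono) auto
    finally show "norm (H s) \<le> exp (1 * (1 + norm s) ^ N)" by simp
  qed auto
  ultimately have "exp_growth (\<lambda>x. (1 + x) ^ N) (cball 0 R \<union> {s. norm s \<ge> R}) H"
    by (rule exp_growth_Un[OF gs])
  also have "cball 0 R \<union> {s. norm s \<ge> R} = UNIV" by auto
  finally show ?thesis using N by blast
qed

section \<open>Analytic continuation and growth of the completed function\<close>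

locale selberg_data =
  fixes a :: "nat \<Rightarrow> complex" and m :: nat and H :: "complex \<Rightarrow> complex"
    and Q :: real and r :: nat and lam :: "nat \<Rightarrow> real" and mu :: "nat \<Rightarrow> complex"
    and \<omega> :: complex and \<xi> :: "complex \<Rightarrow> complex"
  assumes m_def: "m = pole_order a"
    and summ: "\<And>s. Re s > 1 \<Longrightarrow> summable (\<lambda>n. norm (a (Suc n) * of_nat (Suc n) powr (- s)))"
    and nonzero: "\<exists>s. dirichlet_series a s \<noteq> 0"
    and reg: "regularizes a m H"
    and Q: "Q > 0" and lam: "\<And>j. j \<in> {1..r} \<Longrightarrow> lam j > 0" and mu: "\<And>j. j \<in> {1..r} \<Longrightarrow> Re (mu j) \<ge> 0"
    and \<omega>: "norm \<omega> = 1"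
    and \<xi>: "\<xi> = xi_fun a Q r lam mu"
    and feq: "\<And>s. \<xi> s = \<omega> * cnj (\<xi> (1 - cnj s))"
begin

definition gammas :: "complex \<Rightarrow> complex" where
  "gammas s = (\<Prod>j=1..r. Gamma (of_real (lam j) * s + mu j))"

lemma entire_H: "H holomorphic_on UNIV" and H_eq: "Re s > 1 \<Longrightarrow> H s = (s - 1) ^ m * dirichlet_series a s"
  and order_H: "entire_finite_order H"
  using reg by (auto simp: regularizes_def entire_finite_order_def)

lemma Re_gamma_arg_pos: "Re s > 0 \<Longrightarrow> j \<in> {1..r} \<Longrightarrow> Re (of_real (lam j) * s + mu j) > 0"
  using lam[of j] mu[of j] by (simp add: add_pos_nonneg)

lemma gammas_holomorphic: "gammas holomorphic_on {s. Re s > 0}"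
  unfolding gammas_def [abs_def]
  by (intro holomorphic_on_prod holomorphic_Gamma' holomorphic_intros Re_pos_notin_nonpos_Ints Re_gamma_arg_pos) auto

lemma half_plane_formula_holomorphic:
  "(\<lambda>s. s ^ m * of_real Q powr s * gammas s * H s) holomorphic_on {s. Re s > 0}"
  by (intro holomorphic_on_mult holomorphic_on_power holomorphic_on_powr_right holomorphic_on_ident
      gammas_holomorphic holomorphic_on_subset[OF entire_H]) auto

text \<open>For \<open>Re s > 0\<close> no Gamma factor has a pole, and \<open>(s - 1) ^ m\<close>
  cancels the denominator of \<open>continuation\<close>. The two formulas can differ only at
  \<open>s = 1\<close>, where \<open>remove_sings\<close> takes the limit.\<close>

lemma xi_right_half_plane:
  assumes "Re s > 0"
  shows "\<xi> s = s ^ m * of_real Q powr s * gammas s * H s"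
  unfolding \<xi> xi_fun_def
proof (rule remove_sings_eqI)
  let ?X = "\<lambda>s. s ^ m * of_real Q powr s * gammas s * H s"
  have "isCont ?X s"
    using half_plane_formula_holomorphic assms open_halfspace_Re_gt[of 0]
      continuous_on_eq_continuous_at holomorphic_on_imp_continuous_on by blast
  hence "?X \<midarrow>s\<rightarrow> ?X s" by (simp add: isCont_def)
  moreover have "\<forall>\<^sub>F t in at s. t \<noteq> 1" by (rule eventually_neq_at_within)
  hence "\<forall>\<^sub>F t in at s. ?X t = t ^ pole_order a * (t - 1) ^ pole_order a * of_real Q powr t *
       (\<Prod>j=1..r. Gamma (of_real (lam j) * t + mu j)) * continuation a t"
    by eventually_elim (simp add: continuation_eq[OF reg[unfolded m_def]] gammas_def m_def)
  ultimately show "(\<lambda>t. t ^ pole_order a * (t - 1) ^ pole_order a * of_real Q powr t *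
       (\<Prod>j=1..r. Gamma (of_real (lam j) * t + mu j)) * continuation a t) \<midarrow>s\<rightarrow> ?X s"
    by (rule Lim_transform_eventually)
qed

text \<open>The explicit formula covers \<open>Re s > 0\<close> and its reflection covers
  \<open>Re s < 1\<close>. This avoids any discussion of the Gamma poles in the left
  half-plane.\<close>

lemma xi_entire: "\<xi> holomorphic_on UNIV"
proof -
  have right: "\<xi> holomorphic_on {s. Re s > 0}"
    by (rule holomorphic_transform[OF half_plane_formula_holomorphic]) (simp add: xi_right_half_plane)
  have "(\<lambda>s. \<omega> * (cnj \<circ> (\<lambda>s. \<xi> (1 - s)) \<circ> cnj) s) holomorphic_on {s. Re s < 1}"
  proof (intro holomorphic_on_mult holomorphic_on_const holomorphic_on_compose_cnj_cnj)
    have "\<xi> \<circ> (\<lambda>s. 1 - s) holomorphic_on cnj ` {s. Re s < 1}"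
      by (intro holomorphic_on_compose_gen[OF _ right] holomorphic_intros) auto
    thus "(\<lambda>s. \<xi> (1 - s)) holomorphic_on cnj ` {s. Re s < 1}" by (simp add: o_def)
  qed (rule open_halfspace_Re_lt)
  hence "\<xi> holomorphic_on {s. Re s < 1}"
    by (rule holomorphic_transform) (simp add: feq [symmetric])
  with right have "\<xi> holomorphic_on {s. Re s > 0} \<union> {s. Re s < 1}"
    by (intro holomorphic_on_Un open_halfspace_Re_lt open_halfspace_Re_gt)
  also have "{s. Re s > 0} \<union> {s. Re s < 1} = UNIV" by auto
  finally show ?thesis .
qed

lemma norm_xi_reflect: "norm (\<xi> (1 - cnj s)) = norm (\<xi> s)"
  using feq[of s] \<omega> by (simp add: norm_mult)

lemma eventually_zero_free: "\<forall>\<^sub>F b in at_top. \<forall>s. Re s \<ge> b \<longrightarrow> \<xi> s \<noteq> 0"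
proof -
  obtain s0 where s0: "dirichlet_series a s0 \<noteq> 0" using nonzero by blast
  have "\<forall>\<^sub>F b in at_top. \<forall>s. Re s \<ge> b \<longrightarrow> dirichlet_series a s \<noteq> 0"
    by (rule dirichlet_series_nonzero[OF summ s0])
  moreover have "\<forall>\<^sub>F b::real in at_top. b > 1" by (rule eventually_gt_at_top)
  ultimately show ?thesis
  proof eventually_elim
    case (elim b)
    show ?case
    proof (intro allI impI)
      fix s assume s: "b \<le> Re s"
      hence s1: "Re s > 1" "s \<noteq> 1" "s \<noteq> 0" using elim by auto
      have "Gamma (of_real (lam j) * s + mu j) \<noteq> 0" if "j \<in> {1..r}" for j
        using Re_pos_notin_nonpos_Ints[OF Re_gamma_arg_pos[OF _ that]] s1 by (simp add: Gamma_eq_zero_iff)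
      hence "gammas s \<noteq> 0" by (simp add: gammas_def prod_zero_iff)
      thus "\<xi> s \<noteq> 0"
        using s1 elim s Q by (simp add: xi_right_half_plane H_eq powr_def)
    qed
  qed
qed

lemma exp_growth_Q_powr: "growth_scale \<phi> \<Longrightarrow> exp_growth \<phi> S (\<lambda>s. of_real Q powr s)"
proof (rule exp_growth_exp_linear)
  fix s
  have "norm (of_real Q powr s) = exp (Re s * ln Q)" using Q by (simp add: norm_powr_real)
  also have "Re s * ln Q \<le> norm s * \<bar>ln Q\<bar>"
  proof -
    have "Re s * ln Q \<le> \<bar>Re s\<bar> * \<bar>ln Q\<bar>" unfolding abs_mult [symmetric] by (rule abs_ge_self)
    also have "\<dots> \<le> norm s * \<bar>ln Q\<bar>" by (intro mult_right_mono abs_Re_le_cmod) auto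
    finally show ?thesis .
  qed
  also have "\<dots> \<le> \<bar>ln Q\<bar> * (1 + norm s)" by (simp add: algebra_simps)
  finally show "norm (of_real Q powr s) \<le> exp (\<bar>ln Q\<bar> * (1 + norm s))" by simp
qed

text \<open>Here the Dirichlet series is bounded, so only the Gamma factors grow faster than an
  exponential. The condition on \<open>lam j * b\<close> moves their arguments to where
  \<open>Gamma_real_le\<close> applies.\<close>

lemma exp_growth_right:
  assumes b: "b \<ge> 2" "\<And>j. j \<in> {1..r} \<Longrightarrow> lam j * b \<ge> 3 / 2"
  shows "exp_growth subquadratic {s. Re s \<ge> b} \<xi>"
proof -
  note gs = growth_scale_subquadratic
  let ?S = "{s. Re s \<ge> b}"
  obtain K where K: "\<And>s. Re s \<ge> 2 \<Longrightarrow> norm (dirichlet_series a s) \<le> K"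
    using norm_dirichlet_series_le[OF summ] by blast
  have gr: "exp_growth subquadratic ?S (\<lambda>s. Gamma (of_real (lam j) * s + mu j))" if j: "j \<in> {1..r}" for j
  proof -
    define c where "c = 1 + lam j + norm (mu j)"
    have c: "c \<ge> 1" using lam[OF j] by (simp add: c_def)
    have "exp_growth subquadratic {s. Re s \<ge> 3 / 2} Gamma"
      unfolding exp_growth_def
    proof (intro exI[of _ 2] conjI ballI)
      fix s assume "s \<in> {s. Re s \<ge> 3 / 2}"
      hence s: "Re s \<ge> 3 / 2" by simp
      have "norm (Gamma s) \<le> Gamma (Re s)" using s by (intro norm_Gamma_le) auto
      also have "\<dots> \<le> exp (2 * subquadratic (Re s))"
        using Gamma_real_le[OF s] by (simp add: subquadratic_def)
      also have "\<dots> \<le> exp (2 * subquadratic (norm s))"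
        using growth_scaleD(2)[OF gs, of "Re s" "norm s"] s complex_Re_le_cmod[of s] by simp
      finally show "norm (Gamma s) \<le> exp (2 * subquadratic (norm s))" .
    qed auto
    thus ?thesis
    proof (rule exp_growth_compose[OF gs _ c])
      fix s assume s: "s \<in> ?S"
      have "lam j * b \<le> lam j * Re s" using s lam[OF j] by (intro mult_left_mono) auto
      hence "Re (of_real (lam j) * s + mu j) \<ge> 3 / 2" using b(2)[OF j] mu[OF j] by simp
      moreover have "norm (of_real (lam j) * s + mu j) \<le> c * (1 + norm s)"
      proof -
        have "norm (of_real (lam j) * s + mu j) \<le> lam j * norm s + norm (mu j)"
          by (rule order_trans[OF norm_triangle_ineq]) (use lam[OF j] in \<open>simp add: norm_mult\<close>)
        also have "\<dots> \<le> c * (1 + norm s)" using lam[OF j] by (simp add: c_def algebra_simps)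
        finally show ?thesis .
      qed
      ultimately show "of_real (lam j) * s + mu j \<in> {s. Re s \<ge> 3 / 2} \<and> norm (of_real (lam j) * s + mu j) \<le> c * (1 + norm s)"
        by simp
    qed
  qed
  have "exp_growth subquadratic ?S (\<lambda>s. (s + 0) ^ m * of_real Q powr s * gammas s * ((s + - 1) ^ m * dirichlet_series a s))"
    unfolding gammas_def
    by (intro exp_growth_mult exp_growth_power exp_growth_linear exp_growth_Q_powr exp_growth_prod gr gs
        exp_growth_bounded[OF gs, of _ _ K] K) (use b in auto)
  thus ?thesis
    by (rule exp_growth_le) (use b in \<open>auto simp: xi_right_half_plane H_eq\<close>)
qed

text \<open>Stops at the critical line because \<open>Re (mu j) = 0\<close> is allowed and Gamma may
  have a pole on the imaginary axis; reflection supplies the other half. The real parts of the Gamma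
  arguments range over a compact set of positive numbers, so the order comes from
  \<open>H\<close>.\<close>

lemma exp_growth_strip_right:
  assumes b: "b \<ge> 2"
  shows "\<exists>N\<ge>1. exp_growth (\<lambda>x. (1 + x) ^ N) {s. 1 / 2 \<le> Re s \<and> Re s \<le> b} \<xi>"
proof -
  obtain N where N: "N \<ge> 1" "exp_growth (\<lambda>x. (1 + x) ^ N) UNIV H"
    using entire_finite_order_growth[OF order_H] by blast
  note gs = growth_scale_power[OF N(1)]
  let ?S = "{s. 1 / 2 \<le> Re s \<and> Re s \<le> b}"
  have gr: "exp_growth (\<lambda>x. (1 + x) ^ N) ?S (\<lambda>s. Gamma (of_real (lam j) * s + mu j))" if j: "j \<in> {1..r}" for j
  proof -
    have pos: "lam j * x + Re (mu j) > 0" if "x \<ge> 1 / 2" for x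
      using lam[OF j] mu[OF j] that by (intro add_pos_nonneg mult_pos_pos) auto
    have "continuous_on {1 / 2..b} (\<lambda>x. Gamma (lam j * x + Re (mu j)))"
      by (intro continuous_at_imp_continuous_on ballI isCont_Gamma continuous_intros)
         (use pos in \<open>force elim!: nonpos_Ints_cases\<close>)
    hence "compact ((\<lambda>x. Gamma (lam j * x + Re (mu j))) ` {1 / 2..b})"
      by (rule compact_continuous_image) auto
    then obtain B where "\<forall>y\<in>(\<lambda>x. Gamma (lam j * x + Re (mu j))) ` {1 / 2..b}. norm y \<le> B"
      using compact_imp_bounded bounded_iff by blast
    hence B: "\<bar>Gamma (lam j * x + Re (mu j))\<bar> \<le> B" if "x \<in> {1 / 2..b}" for x
      using that by auto
    show ?thesis
    proof (rule exp_growth_bounded[OF gs])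
      fix s assume s: "s \<in> ?S"
      have "norm (Gamma (of_real (lam j) * s + mu j)) \<le> Gamma (Re (of_real (lam j) * s + mu j))"
        by (rule norm_Gamma_le) (use pos[of "Re s"] s in auto)
      also have "\<dots> \<le> B" using B[of "Re s"] s by simp
      finally show "norm (Gamma (of_real (lam j) * s + mu j)) \<le> B" .
    qed
  qed
  have "exp_growth (\<lambda>x. (1 + x) ^ N) ?S (\<lambda>s. (s + 0) ^ m * of_real Q powr s * gammas s * H s)"
    unfolding gammas_def
    by (intro exp_growth_mult exp_growth_power exp_growth_linear exp_growth_Q_powr exp_growth_prod gr gs
        exp_growth_le[OF N(2)]) auto
  hence "exp_growth (\<lambda>x. (1 + x) ^ N) ?S \<xi>"
    by (rule exp_growth_le) (auto simp: xi_right_half_plane)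
  thus ?thesis using N(1) by blast
qed

lemma exp_growth_reflect:
  assumes "growth_scale \<phi>" "exp_growth \<phi> S \<xi>" "\<And>s. s \<in> T \<Longrightarrow> 1 - cnj s \<in> S"
  shows "exp_growth \<phi> T \<xi>"
proof -
  have "exp_growth \<phi> T (\<lambda>s. \<xi> (1 - cnj s))"
  proof (rule exp_growth_compose[OF assms(1,2), of 1])
    show "1 - cnj s \<in> S \<and> norm (1 - cnj s) \<le> 1 * (1 + norm s)" if "s \<in> T" for s
      using assms(3)[OF that] norm_triangle_ineq4[of 1 "cnj s"] by simp
  qed auto
  thus ?thesis by (rule exp_growth_le) (simp add: norm_xi_reflect)
qed

text \<open>On the line \<open>Re s = b\<close> every factor except
  \<open>s ^ m * (s - 1) ^ m\<close> is bounded, and the functional equation carries the bound to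
  \<open>Re s = 1 - b\<close>. Phragmen-Lindelof then fills the strip.\<close>

lemma polynomial_bound_strip:
  assumes b: "b \<ge> 2"
  obtains K where "K > 0" "\<And>s. 1 - b \<le> Re s \<Longrightarrow> Re s \<le> b \<Longrightarrow> norm (\<xi> s) \<le> K * norm (s + of_real b) ^ (2 * m)"
proof -
  define n where "n = 2 * m"
  define S where "S = {s. 1 - b \<le> Re s \<and> Re s \<le> b}"
  obtain N where N: "N \<ge> 1" "exp_growth (\<lambda>x. (1 + x) ^ N) {s. 1 / 2 \<le> Re s \<and> Re s \<le> b} \<xi>"
    using exp_growth_strip_right[OF b] by blast
  note gs = growth_scale_power[OF N(1)]
  have "exp_growth (\<lambda>x. (1 + x) ^ N) {s. 1 - b \<le> Re s \<and> Re s \<le> 1 / 2} \<xi>"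
    by (rule exp_growth_reflect[OF gs N(2)]) auto
  hence "exp_growth (\<lambda>x. (1 + x) ^ N) ({s. 1 / 2 \<le> Re s \<and> Re s \<le> b} \<union> {s. 1 - b \<le> Re s \<and> Re s \<le> 1 / 2}) \<xi>"
    by (intro exp_growth_Un[OF gs] N(2))
  also have "{s. 1 / 2 \<le> Re s \<and> Re s \<le> b} \<union> {s. 1 - b \<le> Re s \<and> Re s \<le> 1 / 2} = S" using b by (auto simp: S_def)
  finally have grS: "exp_growth (\<lambda>x. (1 + x) ^ N) S \<xi>" .
  have sb: "norm (s + of_real b) \<ge> 1" if "s \<in> S" for s
    using complex_Re_le_cmod[of "s + of_real b"] that by (simp add: S_def)
  \<comment> \<open>The shift by 1/2 makes the strip symmetric about the imaginary axis. The divisor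
    removes the polynomial growth on the edges and has modulus at least 1 in the strip, where
    \<open>Re (s + b) \<ge> 1\<close>.\<close>
  define f where "f v = \<xi> (v + 1 / 2) / (v + 1 / 2 + of_real b) ^ n" for v
  obtain K0 where K0: "\<And>s. Re s \<ge> 2 \<Longrightarrow> norm (dirichlet_series a s) \<le> K0"
    using norm_dirichlet_series_le[OF summ] by blast
  define G where "G = (\<Prod>j=1..r. Gamma (lam j * b + Re (mu j)))"
  define K where "K = \<bar>(b + 2) ^ n * (Q powr b * G * K0)\<bar> + 1"
  have G0: "G \<ge> 0" unfolding G_def using lam mu b
    by (intro prod_nonneg Gamma_real_nonneg) (auto intro!: add_pos_nonneg mult_pos_pos)
  have edge: "norm (\<xi> s) \<le> K * norm (s + of_real b) ^ n" if s: "Re s = b" for s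
  proof -
    have "norm s \<le> norm (s + of_real b)" "norm (s - 1) \<le> norm (s + of_real b)"
    proof -
      have "(Re s)\<^sup>2 \<le> (Re s + b)\<^sup>2" "(Re s - 1)\<^sup>2 \<le> (Re s + b)\<^sup>2"
        by (intro power_mono; use s b in simp)+
      thus "norm s \<le> norm (s + of_real b)" "norm (s - 1) \<le> norm (s + of_real b)"
        by (simp_all add: cmod_def)
    qed
    hence A: "norm s ^ m * norm (s - 1) ^ m \<le> norm (s + of_real b) ^ n"
      unfolding n_def mult_2 power_add by (intro mult_mono power_mono) auto
    have g: "norm (gammas s) \<le> G"
      unfolding gammas_def G_def prod_norm [symmetric]
    proof (intro prod_mono conjI)
      fix j assume j: "j \<in> {1..r}"
      show "norm (Gamma (of_real (lam j) * s + mu j)) \<le> Gamma (lam j * b + Re (mu j))"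
        using norm_Gamma_le[OF Re_gamma_arg_pos[OF _ j], of s] s b by simp
    qed auto
    have "norm (\<xi> s) = norm s ^ m * norm (s - 1) ^ m * (Q powr b * norm (gammas s) * norm (dirichlet_series a s))"
      using s b Q by (simp add: xi_right_half_plane H_eq norm_mult norm_power norm_powr_real_powr)
    also have "\<dots> \<le> norm (s + of_real b) ^ n * (Q powr b * G * K0)"
      using A g K0[of s] s b G0 by (intro mult_mono) auto
    also have "\<dots> = 1 * (Q powr b * G * K0) * norm (s + of_real b) ^ n" by simp
    also have "\<dots> \<le> K * norm (s + of_real b) ^ n"
    proof (rule mult_right_mono)
      have "1 * \<bar>Q powr b * G * K0\<bar> \<le> (b + 2) ^ n * \<bar>Q powr b * G * K0\<bar>"
        using b by (intro mult_right_mono one_le_power) auto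
      also have "\<dots> = \<bar>(b + 2) ^ n * (Q powr b * G * K0)\<bar>" using b by (simp add: abs_mult)
      finally show "1 * (Q powr b * G * K0) \<le> K" unfolding K_def by linarith
    qed auto
    finally show ?thesis .
  qed
  \<comment> \<open>The extra factor accounts for the left edge: reflection turns
    \<open>s + b\<close> into \<open>1 - cnj s + b\<close>, whose modulus is at most
    \<open>(2 * b + 2) * \<bar>s + b\<bar>\<close>.\<close>
  define K' where "K' = K * (2 * b + 2) ^ n"
  have K: "K > 0" "K' > 0" using b by (auto simp: K_def K'_def)
  have KK: "K \<le> K'" unfolding K'_def using K b by (simp add: one_le_power)
  have fbound: "norm (\<xi> s) \<le> K' * norm (s + of_real b) ^ n" if s: "Re s = b \<or> Re s = 1 - b" for s
  proof (cases "Re s = b")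
    case True
    thus ?thesis using edge[OF True] KK by (meson mult_right_mono norm_ge_zero order_trans zero_le_power)
  next
    case False
    hence s': "Re s = 1 - b" using s by blast
    hence sS: "s \<in> S" using b by (simp add: S_def)
    have "norm (\<xi> s) = norm (\<xi> (1 - cnj s))" by (simp add: norm_xi_reflect)
    also have "\<dots> \<le> K * norm (1 - cnj s + of_real b) ^ n" by (rule edge) (use s' in simp)
    also have "norm (1 - cnj s + of_real b) \<le> (2 * b + 2) * norm (s + of_real b)"
    proof -
      have "norm (1 - cnj s + of_real b) = norm (of_real (2 * b + 1) - cnj (s + of_real b))" by (simp add: algebra_simps)
      also have "\<dots> \<le> (2 * b + 1) + norm (s + of_real b)"
        by (rule order_trans[OF norm_triangle_ineq4]) (use b in \<open>simp only: complex_mod_cnj norm_of_real abs_of_nonneg\<close>)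
      also have "2 * b + 1 \<le> (2 * b + 1) * norm (s + of_real b)"
        using mult_left_mono[OF sb[OF sS], of "2 * b + 1"] b by simp
      finally show ?thesis by (simp add: algebra_simps)
    qed
    hence "K * norm (1 - cnj s + of_real b) ^ n \<le> K * ((2 * b + 2) * norm (s + of_real b)) ^ n"
      using K by (intro mult_left_mono power_mono) auto
    finally show ?thesis by (simp add: K'_def power_mult_distrib mult_ac)
  qed
  \<comment> \<open>An open neighbourhood of the strip, bounded on the left by the line through the
    only possible pole of \<open>f\<close>.\<close>
  define T where "T = {v. Re v > - 1 / 2 - b}"
  have main: "norm (f v) \<le> K'" if v: "\<bar>Re v\<bar> \<le> b - 1 / 2" for v
  proof -
    obtain D where D: "D \<ge> 0" "\<And>s. s \<in> S \<Longrightarrow> norm (\<xi> s) \<le> exp (D * (1 + norm s) ^ N)"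
      using grS by (auto simp: exp_growth_def)
    have inS: "v + 1 / 2 \<in> S" if "\<bar>Re v\<bar> \<le> b - 1 / 2" for v using that by (auto simp: S_def)
    show ?thesis
    proof (rule phragmen_lindelof_strip[where f = f and s = v and T = T and a = "b - 1 / 2" and D = "D * 2 ^ N" and N = N])
      show "open T" unfolding T_def by (rule open_halfspace_Re_gt)
      show "{s. \<bar>Re s\<bar> \<le> b - 1 / 2} \<subseteq> T" using b by (auto simp: T_def)
      show "f holomorphic_on T"
      proof -
        have "v + 1 / 2 + of_real b \<noteq> 0" if "v \<in> T" for v
        proof
          assume "v + 1 / 2 + of_real b = 0"
          hence "Re (v + 1 / 2 + of_real b) = 0" by simp
          thus False using that by (simp add: T_def)
        qed
        moreover have "\<xi> \<circ> (\<lambda>v. v + 1 / 2) holomorphic_on T"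
          by (rule holomorphic_on_compose_gen[OF _ xi_entire]) (auto intro!: holomorphic_intros)
        ultimately show ?thesis unfolding f_def [abs_def] by (auto intro!: holomorphic_intros simp: o_def)
      qed
      show "norm (f v) \<le> K'" if "\<bar>Re v\<bar> = b - 1 / 2" for v
      proof -
        have "Re (v + 1 / 2) = b \<or> Re (v + 1 / 2) = 1 - b" using that by auto
        from fbound[OF this] have "norm (\<xi> (v + 1 / 2)) \<le> K' * norm (v + 1 / 2 + of_real b) ^ n" .
        moreover have "norm (v + 1 / 2 + of_real b) ^ n > 0" using sb[OF inS[of v]] that by (intro zero_less_power) auto
        ultimately show ?thesis unfolding f_def norm_divide norm_power by (simp only: pos_divide_le_eq)
      qed
      show "norm (f v) \<le> exp (D * 2 ^ N * (1 + norm v) ^ N)" if v: "\<bar>Re v\<bar> \<le> b - 1 / 2" for v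
      proof -
        have "norm (v + 1 / 2 + of_real b) ^ n \<ge> 1" using sb[OF inS[OF v]] by (rule one_le_power)
        hence "norm (f v) \<le> norm (\<xi> (v + 1 / 2)) / 1"
          unfolding f_def norm_divide norm_power by (intro divide_left_mono) auto
        also have "\<dots> \<le> exp (D * (1 + norm (v + 1 / 2)) ^ N)" using D(2)[OF inS[OF v]] by simp
        also have "\<dots> \<le> exp (D * (2 * (1 + norm v)) ^ N)"
        proof -
          have "1 + norm (v + 1 / 2) \<le> 2 * (1 + norm v)" using norm_triangle_ineq[of v "1 / 2"] norm_ge_zero[of v]
            by (simp del: norm_ge_zero)
          thus ?thesis unfolding exp_le_cancel_iff using D(1) by (intro mult_left_mono power_mono) auto
        qed
        finally show ?thesis by (simp only: power_mult_distrib mult.assoc)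
      qed
      show "\<bar>Re v\<bar> \<le> b - 1 / 2" by (rule v)
    qed (use b K D in auto)
  qed
  have "norm (\<xi> s) \<le> K' * norm (s + of_real b) ^ (2 * m)" if "1 - b \<le> Re s" "Re s \<le> b" for s
  proof -
    have "norm (f (s - 1 / 2)) \<le> K'" by (rule main) (use that in auto)
    moreover have "norm (s + of_real b) ^ n > 0" using sb[of s] that by (intro zero_less_power) (auto simp: S_def)
    ultimately show ?thesis by (simp add: f_def norm_divide norm_power pos_divide_le_eq n_def)
  qed
  thus ?thesis using that K by blast
qed

lemma exp_growth_xi: "exp_growth subquadratic UNIV \<xi>"
proof -
  note gs = growth_scale_subquadratic
  \<comment> \<open>Large enough for the Gamma bound to apply to all factors at once; the 2 keeps
    the maximum meaningful for \<open>r = 0\<close> and lies in the region of absolute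
    convergence.\<close>
  define b where "b = Max (insert 2 ((\<lambda>j. 3 / 2 / lam j) ` {1..r}))"
  have b2: "b \<ge> 2" unfolding b_def by (rule Max_ge) auto
  have "lam j * b \<ge> 3 / 2" if j: "j \<in> {1..r}" for j
  proof -
    have "3 / 2 / lam j \<le> b" unfolding b_def by (rule Max_ge) (use j in auto)
    thus ?thesis using lam[OF j] by (simp add: field_simps)
  qed
  hence right: "exp_growth subquadratic {s. Re s \<ge> b} \<xi>" using b2 by (intro exp_growth_right)
  hence left: "exp_growth subquadratic {s. Re s \<le> 1 - b} \<xi>"
    by (rule exp_growth_reflect[OF gs]) auto
  obtain K where K: "K > 0" "\<And>s. 1 - b \<le> Re s \<Longrightarrow> Re s \<le> b \<Longrightarrow> norm (\<xi> s) \<le> K * norm (s + of_real b) ^ (2 * m)"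
    using polynomial_bound_strip[OF b2] by blast
  have "exp_growth subquadratic {s. 1 - b \<le> Re s \<and> Re s \<le> b} (\<lambda>s. of_real K * (s + of_real b) ^ (2 * m))"
    by (intro exp_growth_mult exp_growth_const exp_growth_power exp_growth_linear gs)
  hence "exp_growth subquadratic {s. 1 - b \<le> Re s \<and> Re s \<le> b} \<xi>"
    by (rule exp_growth_le) (use K in \<open>auto simp: norm_mult norm_power\<close>)
  hence "exp_growth subquadratic ({s. 1 - b \<le> Re s \<and> Re s \<le> b} \<union> ({s. Re s \<ge> b} \<union> {s. Re s \<le> 1 - b})) \<xi>"
    by (intro exp_growth_Un[OF gs] right left)
  also have "({s. 1 - b \<le> Re s \<and> Re s \<le> b} \<union> ({s. Re s \<ge> b} \<union> {s. Re s \<le> 1 - b})) = UNIV" by auto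
  finally show ?thesis .
qed

lemma zeros_in_strip: "\<exists>b\<ge>0. \<forall>s. \<xi> s = 0 \<longrightarrow> \<bar>Re s - 1 / 2\<bar> \<le> b"
proof -
  have "\<forall>\<^sub>F b in at_top. (\<forall>s. Re s \<ge> b \<longrightarrow> \<xi> s \<noteq> 0) \<and> b \<ge> 1"
    by (intro eventually_conj eventually_zero_free eventually_ge_at_top)
  then obtain b where b: "\<And>s. Re s \<ge> b \<Longrightarrow> \<xi> s \<noteq> 0" "b \<ge> 1"
    unfolding eventually_at_top_linorder by blast
  have "\<bar>Re s - 1 / 2\<bar> \<le> b" if "\<xi> s = 0" for s
  proof -
    have "\<xi> (1 - cnj s) = 0" using norm_xi_reflect[of s] that by simp
    hence "\<not> Re (1 - cnj s) \<ge> b" "\<not> Re s \<ge> b" using b(1) that by blast+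
    thus ?thesis using b(2) by simp
  qed
  thus ?thesis using b(2) by (intro exI[of _ b]) auto
qed

end

section \<open>The screw function\<close>

text \<open>Passes from an unordered sum over the zeros to a series over \<open>nat\<close>, as the
  Laplace argument uses it. The set may be finite, so indices outside the range contribute
  \<open>0\<close>.\<close>

lemma has_sum_enumerate:
  fixes f :: "'a \<Rightarrow> 'b :: {topological_comm_monoid_add, t2_space}"
  assumes A: "countable A" and f: "(f has_sum S) A"
  shows "(\<lambda>n. if n \<in> to_nat_on A ` A then f (from_nat_into A n) else 0) sums S"
proof -
  let ?I = "to_nat_on A ` A"
  have bij: "inj_on (from_nat_into A) ?I" "from_nat_into A ` ?I = A"
    using A by (auto simp: inj_on_def image_image)
  have "(f has_sum S) (from_nat_into A ` ?I)" using f by (simp only: bij)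
  hence "(f \<circ> from_nat_into A has_sum S) ?I" by (subst (asm) has_sum_reindex[OF bij(1)])
  hence "((\<lambda>n. if n \<in> ?I then f (from_nat_into A n) else 0) has_sum S) UNIV"
    by (subst (asm) has_sum_cong_neutral[where T = UNIV and g = "\<lambda>n. if n \<in> ?I then f (from_nat_into A n) else 0"]) auto
  thus ?thesis by (rule has_sum_imp_sums)
qed

text \<open>Collects what the rest of the argument uses about \<open>\<xi>\<close>; the Dirichlet
  series no longer occurs. The bound \<open>b\<close> is the half-width of a strip containing all
  zeros.\<close>

locale selberg_xi =
  fixes \<xi> :: "complex \<Rightarrow> complex" and \<omega> :: complex and b :: real
  assumes entire: "\<xi> holomorphic_on UNIV"
    and feq: "\<And>s. \<xi> s = \<omega> * cnj (\<xi> (1 - cnj s))" and \<omega>: "norm \<omega> = 1"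
    and growth: "exp_growth subquadratic UNIV \<xi>"
    and b_nonneg: "b \<ge> 0" and strip: "\<And>s. \<xi> s = 0 \<Longrightarrow> \<bar>Re s - 1 / 2\<bar> \<le> b"
    and real_zeros: "\<And>x::real. \<xi> (of_real x) = 0 \<Longrightarrow> x = 1 / 2"
begin

text \<open>In this variable the ordinates are the zeros, the critical line is the real axis and the
  functional equation is a symmetry under conjugation.\<close>

definition h :: "complex \<Rightarrow> complex" where "h z = \<xi> (1 / 2 - \<i> * z)"

lemma h_entire: "h holomorphic_on UNIV"
proof -
  have "\<xi> \<circ> (\<lambda>z. 1 / 2 - \<i> * z) holomorphic_on UNIV"
    by (rule holomorphic_on_compose_gen[OF _ entire]) (auto intro!: holomorphic_intros)
  thus ?thesis by (simp add: h_def [abs_def] o_def)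
qed

text \<open>The point corresponds to \<open>s = 2\<close>, a real number other than 1/2. It
  witnesses that \<open>h\<close> does not vanish identically.\<close>

lemma h_nonzero: "h (3 / 2 * \<i>) \<noteq> 0"
proof -
  have eq: "1 / 2 - \<i> * (3 / 2 * \<i>) = of_real 2" by (simp add: complex_eq_iff)
  show ?thesis
  proof
    assume "h (3 / 2 * \<i>) = 0"
    hence "\<xi> (of_real 2) = 0" unfolding h_def eq .
    from real_zeros[OF this] show False by simp
  qed
qed

lemma h_reflect: "h z = \<omega> * cnj (h (cnj z))"
  unfolding h_def by (subst feq) simp

lemma h_growth: "exp_growth subquadratic UNIV h"
  unfolding h_def [abs_def]
proof (rule exp_growth_compose[OF growth_scale_subquadratic growth, of 1])
  fix z :: complex
  show "1 / 2 - \<i> * z \<in> UNIV \<and> norm (1 / 2 - \<i> * z) \<le> 1 * (1 + norm z)"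
    using norm_triangle_ineq4[of "1 / 2" "\<i> * z"] by (simp add: norm_mult)
qed auto

lemma ordinates_eq: "ordinates \<xi> = {z. h z = 0}"
  by (simp add: ordinates_def h_def)

lemma mult_eq: "mult \<xi> \<gamma> = nat (zorder h \<gamma>)" and mult_pos: "h \<gamma> = 0 \<Longrightarrow> mult \<xi> \<gamma> > 0"
proof -
  have "\<exists>w\<in>UNIV. h w \<noteq> 0" using h_nonzero by blast
  from zorder_exist_zero[OF h_entire open_UNIV connected_UNIV UNIV_I this, of \<gamma>]
  have "if h \<gamma> = 0 then 0 < zorder h \<gamma> else zorder h \<gamma> = 0" by blast
  thus "mult \<xi> \<gamma> = nat (zorder h \<gamma>)" "h \<gamma> = 0 \<Longrightarrow> mult \<xi> \<gamma> > 0"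
    by (auto simp: mult_def ordinates_eq h_def [abs_def, symmetric] split: if_splits)
qed

lemma has_derivative_h: "(h has_field_derivative - \<i> * deriv \<xi> (1 / 2 - \<i> * z)) (at z)"
proof -
  have "(\<xi> has_field_derivative deriv \<xi> (1 / 2 - \<i> * z)) (at (1 / 2 - \<i> * z))"
    using entire by (intro holomorphic_derivI[of _ UNIV]) auto
  moreover have "((\<lambda>z. 1 / 2 - \<i> * z) has_field_derivative - \<i>) (at z)"
    by (auto intro!: derivative_eq_intros)
  ultimately show ?thesis unfolding h_def [abs_def]
    by (subst mult.commute) (rule DERIV_chain2)
qed

lemma deriv_h: "deriv \<xi> (1 / 2 - \<i> * z) = \<i> * deriv h z"
  using DERIV_imp_deriv[OF has_derivative_h[of z]] by simp

lemma deriv_h_reflect: "deriv h z = \<omega> * cnj (deriv h (cnj z))"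
proof -
  have "(h has_field_derivative deriv h (cnj z)) (at (cnj z))"
    using h_entire by (intro holomorphic_derivI[of _ UNIV]) auto
  hence "(cnj \<circ> h \<circ> cnj has_field_derivative cnj (deriv h (cnj z))) (at z)"
    by (rule has_field_derivative_cnj_cnj)
  hence "((\<lambda>z. \<omega> * (cnj \<circ> h \<circ> cnj) z) has_field_derivative \<omega> * cnj (deriv h (cnj z))) (at z)"
    by (rule DERIV_cmult)
  also have "(\<lambda>z. \<omega> * (cnj \<circ> h \<circ> cnj) z) = h"
    unfolding o_def by (rule ext) (rule h_reflect [symmetric])
  finally show ?thesis by (rule DERIV_imp_deriv)
qed

text \<open>By the functional equation \<open>h'/h\<close> is real on the real axis.\<close>

lemma B_const_real: "Im (B_const \<xi>) = 0"
proof -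
  define n where "n = mult \<xi> 0"
  \<comment> \<open>Dividing out the zero at \<open>0\<close> shows that the limit in
    \<open>B_const\<close> exists and equals \<open>deriv k 0 / k 0\<close>; \<open>Lim\<close> says
    nothing before existence is known.\<close>
  define k where "k = zor_poly h 0"
  define L where "L z = deriv \<xi> (1 / 2 - \<i> * z) / \<xi> (1 / 2 - \<i> * z) - \<i> * of_nat n / z" for z
  have "\<exists>w\<in>UNIV. h w \<noteq> 0" using h_nonzero by blast
  from zorder_exist_zero[OF h_entire open_UNIV connected_UNIV UNIV_I this, of 0]
  obtain r where r: "r > 0" "k holomorphic_on cball 0 r"
    "\<And>w. w \<in> cball 0 r \<Longrightarrow> h w = k w * w ^ n \<and> k w \<noteq> 0"
    unfolding diff_zero k_def [symmetric] mult_eq [symmetric] n_def [symmetric] by blast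
  have k: "k holomorphic_on ball 0 r" by (rule holomorphic_on_subset[OF r(2)]) auto
  have L: "L z = \<i> * (deriv k z / k z)" if z: "z \<in> ball 0 r - {0}" for z
  proof -
    have "(k has_field_derivative deriv k z) (at z)"
      using k z by (intro holomorphic_derivI[of _ "ball 0 r"]) auto
    hence d: "((\<lambda>z. k z * z ^ n) has_field_derivative deriv k z * z ^ n + k z * (of_nat n * z ^ (n - 1))) (at z)"
      by (auto intro!: derivative_eq_intros)
    have ev: "eventually (\<lambda>w. k w * w ^ n = h w) (nhds z)"
      using eventually_nhds_in_open[of "ball 0 r" z] z r(3) by (auto elim!: eventually_mono)
    have "(h has_field_derivative deriv k z * z ^ n + k z * (of_nat n * z ^ (n - 1))) (at z)"
      by (rule iffD1[OF DERIV_cong_ev[OF refl ev refl] d])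
    hence "deriv h z = deriv k z * z ^ n + k z * (of_nat n * z ^ (n - 1))" by (rule DERIV_imp_deriv)
    moreover have "h z = k z * z ^ n" "k z \<noteq> 0" using r(3)[of z] z by auto
    moreover have "L z = \<i> * deriv h z / h z - \<i> * of_nat n / z"
      unfolding L_def deriv_h h_def [symmetric] ..
    ultimately show ?thesis using z by (cases n) (auto simp: field_simps)
  qed
  have "((\<lambda>z. \<i> * (deriv k z / k z)) \<longlongrightarrow> \<i> * (deriv k 0 / k 0)) (at 0)"
  proof -
    have "isCont k 0" "isCont (deriv k) 0"
      using k r(1) holomorphic_deriv[OF k open_ball] continuous_on_eq_continuous_at[OF open_ball]
      by (meson centre_in_ball holomorphic_on_imp_continuous_on)+
    moreover have "k 0 \<noteq> 0" using r(1) r(3)[of 0] by simp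
    ultimately show ?thesis unfolding isCont_def by (intro tendsto_intros)
  qed
  moreover have "eventually (\<lambda>z. \<i> * (deriv k z / k z) = L z) (at 0)"
    using eventually_at_in_open[of "ball 0 r" "0 :: complex"] r(1) by (auto simp: L elim!: eventually_mono)
  ultimately have lim: "(L \<longlongrightarrow> \<i> * (deriv k 0 / k 0)) (at 0)" by (rule Lim_transform_eventually)
  hence B: "B_const \<xi> = deriv k 0 / k 0"
    unfolding B_const_def L_def [symmetric, abs_def] n_def [symmetric] L_def [abs_def, symmetric]
    using tendsto_Lim[OF _ lim] by simp
  \<comment> \<open>Since the limit exists, it may be taken along positive reals, where
    \<open>L / \<i>\<close> is real by the two reflection formulas.\<close>
  have "filterlim complex_of_real (at 0) (at_right 0)"
    by (auto simp: filterlim_at eventually_at_filter intro!: tendsto_eq_intros)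
  hence "((\<lambda>x. Im (L (of_real x) / \<i>)) \<longlongrightarrow> Im (\<i> * (deriv k 0 / k 0) / \<i>)) (at_right 0)"
    by (intro tendsto_intros filterlim_compose[OF lim]) auto
  moreover have "Im (L (of_real x) / \<i>) = 0" for x
  proof -
    define R where "R = deriv h (of_real x) / h (of_real x)"
    have "\<omega> \<noteq> 0" using \<omega> by auto
    have "deriv h (of_real x) = \<omega> * cnj (deriv h (of_real x))"
      by (subst deriv_h_reflect) (simp only: complex_cnj_complex_of_real)
    moreover have "h (of_real x) = \<omega> * cnj (h (of_real x))"
      by (subst h_reflect) (simp only: complex_cnj_complex_of_real)
    ultimately have "R = (\<omega> * cnj (deriv h (of_real x))) / (\<omega> * cnj (h (of_real x)))"
      unfolding R_def by (rule arg_cong2)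
    also have "\<dots> = cnj R" using \<open>\<omega> \<noteq> 0\<close> by (simp add: R_def)
    finally have "Im R = 0" by (metis Reals_cnj_iff complex_is_Real_iff)
    moreover have "L (of_real x) = \<i> * (R - of_real (real n / x))"
      unfolding L_def deriv_h h_def [symmetric] R_def by (simp add: right_diff_distrib)
    ultimately show ?thesis by simp
  qed
  ultimately have "((\<lambda>x::real. 0) \<longlongrightarrow> Im (B_const \<xi>)) (at_right (0::real))" by (simp add: B)
  thus ?thesis by (simp add: tendsto_const_iff)
qed

definition screw_sum :: "real \<Rightarrow> complex" where
  "screw_sum t = (\<Sum>\<^sub>\<infinity>\<gamma>\<in>ordinates \<xi> - {0}. of_nat (mult \<xi> \<gamma>) * (exp (- \<i> * \<gamma> * of_real t) - 1) / \<gamma> ^ 2)"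

lemma Re_screw_function: "Re (- screw_function \<xi> t) = real (mult \<xi> 0) / 2 * t\<^sup>2 - Re (screw_sum t)"
proof -
  have "Re (- \<i> * B_const \<xi> * of_real t) = 0" using B_const_real by simp
  moreover have "Re (of_nat (mult \<xi> 0) / 2 * complex_of_real t ^ 2) = real (mult \<xi> 0) / 2 * t\<^sup>2"
    by (simp add: of_real_power [symmetric] del: of_real_power)
  ultimately show ?thesis unfolding screw_function_def screw_sum_def [symmetric] by simp
qed

lemma GRH_imp_nonneg:
  assumes "GRH \<xi>" shows "Re (- screw_function \<xi> t) \<ge> 0"
proof -
  define f where "f \<gamma> = of_nat (mult \<xi> \<gamma>) * (exp (- \<i> * \<gamma> * of_real t) - 1) / \<gamma> ^ 2" for \<gamma>
  have f: "Re (f \<gamma>) \<le> 0" if "\<gamma> \<in> ordinates \<xi> - {0}" for \<gamma>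
  proof -
    have "Re (1 / 2 - \<i> * \<gamma>) = 1 / 2" using assms that unfolding GRH_def ordinates_def by blast
    hence "\<gamma> = of_real (Re \<gamma>)" by (simp add: complex_eq_iff)
    then obtain x where x: "\<gamma> = of_real x" by blast
    have "exp (- \<i> * \<gamma> * of_real t) = cis (- (x * t))" by (simp add: x cis_conv_exp mult_ac)
    hence "f \<gamma> = of_real (real (mult \<xi> \<gamma>) / x\<^sup>2) * (cis (- (x * t)) - 1)"
      by (simp add: f_def x)
    hence "Re (f \<gamma>) = real (mult \<xi> \<gamma>) / x\<^sup>2 * (cos (x * t) - 1)" by simp
    also have "\<dots> \<le> 0" by (intro mult_nonneg_nonpos) auto
    finally show ?thesis .
  qed
  have "Re (screw_sum t) \<le> 0"
  \<comment> \<open>The sign holds either way: \<open>infsum\<close> has the default value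
    \<open>0\<close> when the sum does not exist, so this direction can do without
    convergence.\<close>
  proof (cases "f summable_on (ordinates \<xi> - {0})")
    case True
    hence "(f has_sum screw_sum t) (ordinates \<xi> - {0})"
      unfolding screw_sum_def f_def by (rule has_sum_infsum)
    hence "((\<lambda>\<gamma>. - Re (f \<gamma>)) has_sum - Re (screw_sum t)) (ordinates \<xi> - {0})"
      by (intro has_sum_uminusI has_sum_Re)
    hence "- Re (screw_sum t) \<ge> 0" by (rule has_sum_nonneg) (use f in auto)
    thus ?thesis by simp
  next
    case False
    hence "screw_sum t = 0" unfolding screw_sum_def f_def by (rule infsum_not_exists)
    thus ?thesis by simp
  qed
  moreover have "0 \<le> real (mult \<xi> 0) / 2 * t\<^sup>2" by simp
  ultimately show ?thesis unfolding Re_screw_function by linarith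
qed

section \<open>From nonnegativity to the zeros\<close>

lemma finite_ordinates: "finite {\<gamma> \<in> ordinates \<xi> - {0}. norm \<gamma> \<le> R}"
  by (rule finite_subset[OF _ finite_zeros_cball[OF h_entire h_nonzero, of 0 R]]) (auto simp: ordinates_eq)

lemma countable_ordinates: "countable (ordinates \<xi> - {0})"
proof -
  have "countable (\<Union>n. {\<gamma> \<in> ordinates \<xi> - {0}. norm \<gamma> \<le> real n})"
    by (rule countable_UN[OF countableI_type countable_finite[OF finite_ordinates]])
  moreover have "ordinates \<xi> - {0} \<subseteq> (\<Union>n. {\<gamma> \<in> ordinates \<xi> - {0}. norm \<gamma> \<le> real n})"
  proof
    fix \<gamma> assume "\<gamma> \<in> ordinates \<xi> - {0}"
    moreover obtain n where "norm \<gamma> \<le> real n" using real_arch_simple by blast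
    ultimately show "\<gamma> \<in> (\<Union>n. {\<gamma> \<in> ordinates \<xi> - {0}. norm \<gamma> \<le> real n})" by blast
  qed
  ultimately show ?thesis by (rule countable_subset[rotated])
qed

lemma summable_ordinates: "(\<lambda>\<gamma>. real (mult \<xi> \<gamma>) / norm \<gamma> ^ 2) summable_on (ordinates \<xi> - {0})"
proof -
  have "{w. h w = 0 \<and> w \<noteq> 0} = ordinates \<xi> - {0}" by (auto simp: ordinates_eq)
  thus ?thesis using summable_zeros[OF h_entire h_nonzero h_growth] by (simp add: mult_eq)
qed

lemma Im_ordinates: "\<gamma> \<in> ordinates \<xi> \<Longrightarrow> \<bar>Im \<gamma>\<bar> \<le> b"
  using strip[of "1 / 2 - \<i> * \<gamma>"] by (simp add: ordinates_def)

text \<open>For fixed \<open>t\<close> the exponentials are bounded because the ordinates lie in the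
  horizontal strip \<open>\<bar>Im \<gamma>\<bar> \<le> b\<close>; the weights
  \<open>m / \<bar>\<gamma>\<bar>^2\<close> then give absolute convergence.\<close>

lemma has_sum_screw_sum:
  assumes "t \<ge> 0"
  shows "((\<lambda>\<gamma>. of_nat (mult \<xi> \<gamma>) * (1 - exp (- \<i> * \<gamma> * of_real t)) / \<gamma> ^ 2) has_sum - screw_sum t) (ordinates \<xi> - {0})"
proof -
  define f where "f \<gamma> = of_nat (mult \<xi> \<gamma>) * (exp (- \<i> * \<gamma> * of_real t) - 1) / \<gamma> ^ 2" for \<gamma>
  have "(\<lambda>\<gamma>. norm (f \<gamma>)) summable_on (ordinates \<xi> - {0})"
  proof (rule summable_on_comparison_test)
    show "(\<lambda>\<gamma>. real (mult \<xi> \<gamma>) / norm \<gamma> ^ 2 * (1 + exp (b * t))) summable_on (ordinates \<xi> - {0})"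
      by (intro summable_on_cmult_left summable_ordinates)
    fix \<gamma> assume "\<gamma> \<in> ordinates \<xi> - {0}"
    hence "Im \<gamma> * t \<le> b * t" using Im_ordinates[of \<gamma>] assms by (intro mult_right_mono) auto
    moreover have "norm (exp (- \<i> * \<gamma> * of_real t) - 1) \<le> exp (Im \<gamma> * t) + 1"
      by (rule norm_triangle_ineq4[THEN order_trans]) simp
    ultimately have "norm (exp (- \<i> * \<gamma> * of_real t) - 1) \<le> 1 + exp (b * t)"
      by (smt (verit) exp_le_cancel_iff)
    hence "real (mult \<xi> \<gamma>) / norm \<gamma> ^ 2 * norm (exp (- \<i> * \<gamma> * of_real t) - 1)
        \<le> real (mult \<xi> \<gamma>) / norm \<gamma> ^ 2 * (1 + exp (b * t))" by (intro mult_left_mono) auto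
    thus "norm (f \<gamma>) \<le> real (mult \<xi> \<gamma>) / norm \<gamma> ^ 2 * (1 + exp (b * t))"
      by (simp add: f_def norm_mult norm_divide norm_power)
  qed auto
  hence "f summable_on (ordinates \<xi> - {0})" by (rule abs_summable_summable)
  hence "(f has_sum screw_sum t) (ordinates \<xi> - {0})"
    unfolding screw_sum_def f_def by (rule has_sum_infsum)
  hence "((\<lambda>\<gamma>. - f \<gamma>) has_sum - screw_sum t) (ordinates \<xi> - {0})" by (rule has_sum_uminusI)
  moreover have "(\<lambda>\<gamma>. - f \<gamma>) = (\<lambda>\<gamma>. of_nat (mult \<xi> \<gamma>) * (1 - exp (- \<i> * \<gamma> * of_real t)) / \<gamma> ^ 2)"
    by (rule ext) (simp only: f_def minus_divide_left mult_minus_right [symmetric] minus_diff_eq)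
  ultimately show ?thesis by simp
qed

lemma nonneg_imp_Im_ordinate_nonpos:
  assumes t0: "t0 \<ge> 0" "\<And>t. t \<ge> t0 \<Longrightarrow> Re (- screw_function \<xi> t) \<ge> 0"
    and \<gamma>: "\<gamma> \<in> ordinates \<xi>"
  shows "Im \<gamma> \<le> 0"
proof (cases "\<gamma> = 0")
  case False
  let ?A = "ordinates \<xi> - {0}"
  define I where "I = to_nat_on ?A ` ?A"
  \<comment> \<open>The value 1 off the index set only has to be nonzero; such indices carry weight
    \<open>0\<close>.\<close>
  define z where "z n = (if n \<in> I then from_nat_into ?A n else 1)" for n
  define w where "w n = (if n \<in> I then real (mult \<xi> (z n)) else 0)" for n
  have zA: "z n \<in> ?A \<and> to_nat_on ?A (z n) = n" if "n \<in> I" for n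
    using that countable_ordinates by (auto simp: z_def I_def)
  interpret weighted_points z w
  proof
    show "w n \<ge> 0" for n by (simp add: w_def)
    show "z n \<noteq> 0" for n using zA[of n] by (cases "n \<in> I") (auto simp: z_def)
    have "summable (\<lambda>n. if n \<in> I then real (mult \<xi> (from_nat_into ?A n)) / norm (from_nat_into ?A n) ^ 2 else 0)"
      using has_sum_enumerate[OF countable_ordinates has_sum_infsum[OF summable_ordinates]]
      unfolding I_def by (rule sums_summable)
    also have "(\<lambda>n. if n \<in> I then real (mult \<xi> (from_nat_into ?A n)) / norm (from_nat_into ?A n) ^ 2 else 0)
        = (\<lambda>n. w n / norm (z n) ^ 2)" by (auto simp: w_def z_def)
    finally show "summable (\<lambda>n. w n / norm (z n) ^ 2)" .
    show "finite {n. w n \<noteq> 0 \<and> norm (z n) \<le> R}" for R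
    proof (rule finite_subset)
      show "finite (to_nat_on ?A ` {\<gamma> \<in> ?A. norm \<gamma> \<le> R})" using finite_ordinates by blast
      show "{n. w n \<noteq> 0 \<and> norm (z n) \<le> R} \<subseteq> to_nat_on ?A ` {\<gamma> \<in> ?A. norm \<gamma> \<le> R}"
      proof
        fix n assume n: "n \<in> {n. w n \<noteq> 0 \<and> norm (z n) \<le> R}"
        hence "n \<in> I" by (auto simp: w_def split: if_splits)
        thus "n \<in> to_nat_on ?A ` {\<gamma> \<in> ?A. norm \<gamma> \<le> R}"
          using zA[of n] n by (intro image_eqI[of _ _ "z n"]) auto
      qed
    qed
  qed
  define m where "m = to_nat_on ?A \<gamma>"
  have m: "m \<in> I" "z m = \<gamma>" using \<gamma> False countable_ordinates by (auto simp: m_def I_def z_def)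
  have wI: "n \<in> I" if "w n \<noteq> 0" for n using that by (auto simp: w_def split: if_splits)
  have "Im (z m) \<le> 0"
  proof (rule nonneg_imp_Im_nonpos)
    show "\<bar>Im (z n)\<bar> \<le> b" if "w n \<noteq> 0" for n using Im_ordinates zA wI[OF that] by blast
    \<comment> \<open>A purely imaginary nonzero ordinate would be a real zero of
      \<open>\<xi>\<close> different from 1/2, so the assumption on real zeros enters here.\<close>
    show "Re (z n) \<noteq> 0" if "w n \<noteq> 0" for n
    proof
      assume "Re (z n) = 0"
      hence zn: "z n = \<i> * of_real (Im (z n))" by (simp add: complex_eq_iff)
      have "z n \<in> ?A" using zA wI[OF that] by blast
      hence "\<xi> (1 / 2 - \<i> * z n) = 0" "z n \<noteq> 0" by (auto simp: ordinates_def)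
      moreover have "1 / 2 - \<i> * z n = of_real (1 / 2 + Im (z n))"
        by (subst zn) (simp add: complex_eq_iff)
      ultimately have "1 / 2 + Im (z n) = 1 / 2" using real_zeros by metis
      thus False using \<open>z n \<noteq> 0\<close> zn by simp
    qed
    show "real (mult \<xi> 0) / 2 * t\<^sup>2 + Re (\<Sum>n. osc_term n t) \<ge> 0" if t: "t \<ge> t0" for t
    proof -
      have "t \<ge> 0" using t t0 by simp
      from has_sum_enumerate[OF countable_ordinates has_sum_screw_sum[OF this]]
      have "(\<lambda>n. osc_term n t) sums (- screw_sum t)"
        unfolding I_def [symmetric] by (rule sums_cong[THEN iffD1, rotated]) (auto simp: osc_term_def w_def z_def)
      thus ?thesis using t0(2)[OF t] unfolding Re_screw_function by (simp add: sums_iff)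
    qed
    show "w m \<noteq> 0" using m \<gamma> mult_pos by (simp add: w_def ordinates_eq)
  qed (rule b_nonneg)
  thus ?thesis by (simp add: m)
qed simp

text \<open>A zero \<open>s\<close> has the ordinate \<open>\<i> * (s - 1 / 2)\<close>, with
  imaginary part \<open>Re s - 1 / 2\<close>. The one-sided bound applies to \<open>s\<close> and to
  the zero \<open>1 - cnj s\<close>, which forces equality.\<close>

lemma nonneg_imp_GRH:
  assumes t0: "t0 \<ge> 0" "\<And>t. t \<ge> t0 \<Longrightarrow> Re (- screw_function \<xi> t) \<ge> 0"
  shows "GRH \<xi>"
  unfolding GRH_def
proof (intro allI impI)
  have le: "Re s \<le> 1 / 2" if "\<xi> s = 0" for s
  proof -
    have "1 / 2 - \<i> * (\<i> * (s - 1 / 2)) = s" by (simp add: mult.assoc [symmetric])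
    hence "\<i> * (s - 1 / 2) \<in> ordinates \<xi>" using that by (simp add: ordinates_def)
    from nonneg_imp_Im_ordinate_nonpos[OF t0 this] show ?thesis by simp
  qed
  fix s assume s: "\<xi> s = 0"
  have "\<xi> (1 - cnj s) = 0" using feq[of "1 - cnj s"] s by simp
  from le[OF this] le[OF s] show "Re s = 1 / 2" by simp
qed

end

lemma selberg_xi_completed:
  assumes "a \<in> extended_selberg_class" "completed a \<xi>" "\<forall>x::real. \<xi> (of_real x) = 0 \<longrightarrow> x = 1 / 2"
  obtains \<omega> b where "selberg_xi \<xi> \<omega> b"
proof -
  obtain Q r lam mu \<omega> where *: "Q > 0" "\<forall>j\<in>{1..r}. lam j > 0 \<and> Re (mu j) \<ge> 0" "norm \<omega> = 1"
    "\<xi> = xi_fun a Q r lam mu" "\<forall>s. \<xi> s = \<omega> * cnj (\<xi> (1 - cnj s))"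
    using assms(2) unfolding completed_def by blast
  have "\<exists>m. \<exists>H. regularizes a m H" using assms(1) by (auto simp: extended_selberg_class_def)
  hence "\<exists>H. regularizes a (pole_order a) H" unfolding pole_order_def by (rule LeastI_ex)
  then obtain H where H: "regularizes a (pole_order a) H" by blast
  interpret selberg_data a "pole_order a" H Q r lam mu \<omega> \<xi>
  proof
    show "summable (\<lambda>n. norm (a (Suc n) * of_nat (Suc n) powr (- s)))" if "Re s > 1" for s
      using assms(1) that unfolding extended_selberg_class_def by blast
    show "\<exists>s. dirichlet_series a s \<noteq> 0" using assms(1) unfolding extended_selberg_class_def by blast
  qed (use * H in blast)+
  obtain b where b: "b \<ge> 0" "\<forall>s. \<xi> s = 0 \<longrightarrow> \<bar>Re s - 1 / 2\<bar> \<le> b" using zeros_in_strip by blast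
  have "selberg_xi \<xi> \<omega> b"
    by unfold_locales (use xi_entire feq \<omega> exp_growth_xi b assms(3) in blast)+
  thus ?thesis by (rule that)
qed

theorem theorem1p1:
  fixes a :: "nat \<Rightarrow> complex" and \<xi> :: "complex \<Rightarrow> complex"
  assumes "a \<in> extended_selberg_class"
    and "completed a \<xi>"
    and "\<forall>x::real. \<xi> (of_real x) = 0 \<longrightarrow> x = 1 / 2"
  shows "GRH \<xi> \<longleftrightarrow> (\<exists>t0\<ge>0. \<forall>t\<ge>t0. Re (- screw_function \<xi> t) \<ge> 0)"
proof -
  obtain \<omega> b where "selberg_xi \<xi> \<omega> b" using selberg_xi_completed[OF assms] .
  then interpret selberg_xi \<xi> \<omega> b .
  show ?thesis using GRH_imp_nonneg nonneg_imp_GRH by blast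
qed

end
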